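(* Let $\mathbb{X}\subseteq\mathbb{P}^1$ be a $0$-dimensional scheme with $I_{\mathbb{X}}=\langle F\rangle$, where $F=\prod_{i=1}^s(X_1-a_iX_0)^{m_i}$ for some $s\ge 1$, $m_1,\dots,m_s\ge 1$, and $a_1,\dots,a_s\in K$ with $a_i\ne a_j$ for $i\ne j$, and let $\mu=\sum_{i=1}^s m_i$. Then the Hilbert functions of $\Omega^1_{R_{\mathbb{X}}/K}$ and $\Omega^2_{R_{\mathbb{X}}/K}$ are, listing values in degrees $0,1,2,\dots$, $$\mathrm{HF}_{\Omega^1_{R_{\mathbb{X}}/K}}:\ 0\ \ 2\ \ 4\ \ 6\ \cdots\ 2(\mu-2)\ \ 2(\mu-1)\ \ 2\mu-1\ \ 2\mu-2\ \cdots\ 2\mu-s\ \ 2\mu-s\ \cdots$$ $$\mathrm{HF}_{\Omega^2_{R_{\mathbb{X}}/K}}:\ 0\ \ 0\ \ 1\ \ 2\ \cdots\ \mu-2\ \ \mu-1\ \ \mu-2\ \ \mu-3\ \cdots\ \mu-s\ \ \mu-s\ \cdots$$ That is, $\mathrm{HF}_{\Omega^1_{R_{\mathbb{X}}/K}}(i)=2i$ for $0\le i\le\mu-1$, $=3\mu-1-i$ for $\mu\le i\le\mu+s-1$, and $=2\mu-s$ for $i\ge\mu+s-1$; and $\mathrm{HF}_{\Omega^2_{R_{\mathbb{X}}/K}}(0)=0$, $\mathrm{HF}_{\Omega^2_{R_{\mathbb{X}}/K}}(i)=i-1$ for $1\le i\le\mu$, $=2\mu-1-i$ for $\mu\le i\le\mu+s-1$,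 and $=\mu-s$ for $i\ge\mu+s-1$. In particular, we have $\mathrm{ri}(\Omega^1_{R_{\mathbb{X}}/K})=\mathrm{ri}(\Omega^2_{R_{\mathbb{X}}/K})=\mu+s-1$.
   Context: $K$ is a field of characteristic zero, $S=K[X_0,X_1]$ with the standard grading is the homogeneous coordinate ring of $\mathbb{P}^1$ over $K$. For a $0$-dimensional subscheme $\mathbb{X}\subseteq\mathbb{P}^1$, $I_{\mathbb{X}}\subseteq S$ is its saturated homogeneous vanishing ideal, $R_{\mathbb{X}}=S/I_{\mathbb{X}}$, and $x_i$ is the image of $X_i$. $\Omega^1_{R_{\mathbb{X}}/K}$ is the module of Kähler differentials of $R_{\mathbb{X}}/K$, a graded $R_{\mathbb{X}}$-module with $\deg(dx_i)=1$, and $\Omega^m_{R_{\mathbb{X}}/K}=\bigwedge^m_{R_{\mathbb{X}}}\Omega^1_{R_{\mathbb{X}}/K}$. For a finitely generated graded module $M$, $\mathrm{HF}_M(i)=\dim_K M_i$, $\mathrm{HP}_M$ is its Hilbert polynomial, and the regularity index is $\mathrm{ri}(M)=\min\{i\in\mathbb{Z}\mid \mathrm{HF}_M(j)=\mathrm{HP}_M(j)\text{ for all }j\ge i\}$.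
   Formalization: The claim ri(Ω²)=μ+s−1 is stated only for μ≥2: when μ=1 (one reduced point) Ω²=0, so HF=HP=0 in all integer degrees and the minimum defining ri(Ω²) does not exist. *)

theory Defs
  imports
    "HOL-Algebra.QuotRing"
    "HOL-Algebra.Algebraic_Closure_Type"
    "Jordan_Normal_Form.Missing_VectorSpace"
begin

section \<open>Modules given by generators and relations\<close>

text \<open>The fields \<open>mult\<close> and \<open>one\<close>, which records of modules inherit from records of
  rings, carry no meaning for modules and are left undefined.\<close>

definition free_module ::
    "('r, 'm) ring_scheme \<Rightarrow> 'x set \<Rightarrow> ('r, 'x \<Rightarrow> 'r) module" where
  "free_module R B =
     \<lparr>carrier = {f. (\<forall>x. f x \<in> carrier R) \<and> (\<forall>x. x \<notin> B \<longrightarrow> f x = \<zero>\<^bsub>R\<^esub>) \<and> finite {x. f x \<noteq> \<zero>\<^bsub>R\<^esub>}},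
      monoid.mult = undefined, monoid.one = undefined,
      ring.zero = (\<lambda>x. \<zero>\<^bsub>R\<^esub>),
      ring.add = (\<lambda>f g x. f x \<oplus>\<^bsub>R\<^esub> g x),
      module.smult = (\<lambda>r f x. r \<otimes>\<^bsub>R\<^esub> f x)\<rparr>"

definition free_gen :: "('r, 'm) ring_scheme \<Rightarrow> 'x \<Rightarrow> 'x \<Rightarrow> 'r" where
  "free_gen R x = (\<lambda>y. if y = x then \<one>\<^bsub>R\<^esub> else \<zero>\<^bsub>R\<^esub>)"

definition quot_module ::
    "('r, 'v, 'm) module_scheme \<Rightarrow> 'v set \<Rightarrow> ('r, 'v set) module" where
  "quot_module M N =
     \<lparr>carrier = a_rcosets\<^bsub>M\<^esub> N,
      monoid.mult = undefined, monoid.one = undefined,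
      ring.zero = N,
      ring.add = set_add M,
      module.smult = (\<lambda>r C. \<Union>x\<in>C. N +>\<^bsub>M\<^esub> (r \<odot>\<^bsub>M\<^esub> x))\<rparr>"

definition regular_module :: "('r, 'm) ring_scheme \<Rightarrow> ('r, 'r) module" where
  "regular_module R =
     \<lparr>carrier = carrier R, monoid.mult = undefined, monoid.one = undefined,
      ring.zero = \<zero>\<^bsub>R\<^esub>, ring.add = ring.add R, module.smult = monoid.mult R\<rparr>"

definition restrict_scalars ::
    "('k \<Rightarrow> 'r) \<Rightarrow> ('r, 'v, 'm) module_scheme \<Rightarrow> ('k, 'v) module" where
  "restrict_scalars \<phi> M =
     \<lparr>carrier = carrier M, monoid.mult = undefined, monoid.one = undefined,
      ring.zero = \<zero>\<^bsub>M\<^esub>, ring.add = ring.add M, module.smult = (\<lambda>c x. \<phi> c \<odot>\<^bsub>M\<^esub> x)\<rparr>"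


section \<open>Kaehler differentials\<close>

text \<open>Throughout, a \<open>K\<close>-algebra is a ring \<open>R\<close> with a structure map \<open>\<phi>\<close> from \<open>K\<close> to \<open>R\<close>.
  The module of Kaehler differentials is the free \<open>R\<close>-module on symbols \<open>dr\<close> modulo additivity of
  \<open>d\<close>, the Leibniz rule, and \<open>dc = 0\<close> for all constants \<open>c\<close>; together these make \<open>d\<close> the
  universal \<open>K\<close>-linear derivation.\<close>

definition kaehler_rels ::
    "('k, 'n) ring_scheme \<Rightarrow> ('k \<Rightarrow> 'r) \<Rightarrow> ('r, 'm) ring_scheme \<Rightarrow> ('r \<Rightarrow> 'r) set" where
  "kaehler_rels K \<phi> R =
     (let M = free_module R (carrier R); \<delta> = free_gen R in
        {\<delta> (r \<oplus>\<^bsub>R\<^esub> s) \<ominus>\<^bsub>M\<^esub> (\<delta> r \<oplus>\<^bsub>M\<^esub> \<delta> s) | r s. r \<in> carrier R \<and> s \<in> carrier R}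
      \<union> {\<delta> (r \<otimes>\<^bsub>R\<^esub> s) \<ominus>\<^bsub>M\<^esub> (r \<odot>\<^bsub>M\<^esub> \<delta> s \<oplus>\<^bsub>M\<^esub> s \<odot>\<^bsub>M\<^esub> \<delta> r) | r s. r \<in> carrier R \<and> s \<in> carrier R}
      \<union> {\<delta> (\<phi> c) | c. c \<in> carrier K})"

definition kaehler_submodule ::
    "('k, 'n) ring_scheme \<Rightarrow> ('k \<Rightarrow> 'r) \<Rightarrow> ('r, 'm) ring_scheme \<Rightarrow> ('r \<Rightarrow> 'r) set" where
  "kaehler_submodule K \<phi> R =
     module.span R (free_module R (carrier R)) (kaehler_rels K \<phi> R)"

definition kaehler ::
    "('k, 'n) ring_scheme \<Rightarrow> ('k \<Rightarrow> 'r) \<Rightarrow> ('r, 'm) ring_scheme \<Rightarrow> ('r, ('r \<Rightarrow> 'r) set) module" where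
  "kaehler K \<phi> R = quot_module (free_module R (carrier R)) (kaehler_submodule K \<phi> R)"

definition kaehler_d ::
    "('k, 'n) ring_scheme \<Rightarrow> ('k \<Rightarrow> 'r) \<Rightarrow> ('r, 'm) ring_scheme \<Rightarrow> 'r \<Rightarrow> ('r \<Rightarrow> 'r) set" where
  "kaehler_d K \<phi> R r = kaehler_submodule K \<phi> R +>\<^bsub>free_module R (carrier R)\<^esub> free_gen R r"

text \<open>For a graded algebra \<open>R\<close>, with homogeneous component \<open>gr i\<close> in degree \<open>i\<close>, the module of
  differentials carries the grading for which \<open>d\<close> is homogeneous of degree \<open>0\<close>, so that
  \<open>deg (dx) = deg x\<close>.\<close>

definition kaehler_part ::
    "('k, 'n) ring_scheme \<Rightarrow> ('k \<Rightarrow> 'r) \<Rightarrow> ('r, 'm) ring_scheme \<Rightarrow> (int \<Rightarrow> 'r set)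
      \<Rightarrow> int \<Rightarrow> ('r \<Rightarrow> 'r) set set" where
  "kaehler_part K \<phi> R gr i =
     module.span K (restrict_scalars \<phi> (kaehler K \<phi> R))
       {f \<odot>\<^bsub>kaehler K \<phi> R\<^esub> kaehler_d K \<phi> R g | f g a b. f \<in> gr a \<and> g \<in> gr b \<and> a + b = i}"


section \<open>Exterior powers\<close>

text \<open>The \<open>n\<close>-th exterior power of \<open>M\<close> is the free module on \<open>n\<close>-tuples of elements of \<open>M\<close>
  (lists of length \<open>n\<close>) modulo additivity and homogeneity in each position and modulo the
  tuples that have a repeated entry.\<close>

definition tuples :: "('r, 'v, 'm) module_scheme \<Rightarrow> nat \<Rightarrow> 'v list set" where
  "tuples M n = {xs. length xs = n \<and> set xs \<subseteq> carrier M}"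

definition exterior_rels ::
    "('r, 'l) ring_scheme \<Rightarrow> ('r, 'v, 'm) module_scheme \<Rightarrow> nat \<Rightarrow> ('v list \<Rightarrow> 'r) set" where
  "exterior_rels R M n =
     (let L = free_module R (tuples M n); \<delta> = free_gen R in
        {\<delta> (xs[i := v \<oplus>\<^bsub>M\<^esub> w]) \<ominus>\<^bsub>L\<^esub> (\<delta> (xs[i := v]) \<oplus>\<^bsub>L\<^esub> \<delta> (xs[i := w])) | xs i v w.
           xs \<in> tuples M n \<and> i < n \<and> v \<in> carrier M \<and> w \<in> carrier M}
      \<union> {\<delta> (xs[i := r \<odot>\<^bsub>M\<^esub> v]) \<ominus>\<^bsub>L\<^esub> r \<odot>\<^bsub>L\<^esub> \<delta> (xs[i := v]) | xs i r v.
           xs \<in> tuples M n \<and> i < n \<and> r \<in> carrier R \<and> v \<in> carrier M}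
      \<union> {\<delta> xs | xs. xs \<in> tuples M n \<and> \<not> distinct xs})"

definition exterior_submodule ::
    "('r, 'l) ring_scheme \<Rightarrow> ('r, 'v, 'm) module_scheme \<Rightarrow> nat \<Rightarrow> ('v list \<Rightarrow> 'r) set" where
  "exterior_submodule R M n = module.span R (free_module R (tuples M n)) (exterior_rels R M n)"

definition exterior_power ::
    "('r, 'l) ring_scheme \<Rightarrow> ('r, 'v, 'm) module_scheme \<Rightarrow> nat \<Rightarrow> ('r, ('v list \<Rightarrow> 'r) set) module" where
  "exterior_power R M n = quot_module (free_module R (tuples M n)) (exterior_submodule R M n)"

definition wedge ::
    "('r, 'l) ring_scheme \<Rightarrow> ('r, 'v, 'm) module_scheme \<Rightarrow> 'v list \<Rightarrow> ('v list \<Rightarrow> 'r) set" where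
  "wedge R M xs =
     exterior_submodule R M (length xs) +>\<^bsub>free_module R (tuples M (length xs))\<^esub> free_gen R xs"

text \<open>Here \<open>gr\<close> and \<open>grM\<close> are the gradings of \<open>R\<close> and \<open>M\<close>. The coefficient \<open>f\<close> only matters
  for the power \<open>n = 0\<close>.\<close>

definition exterior_part ::
    "('k, 'p) ring_scheme \<Rightarrow> ('k \<Rightarrow> 'r) \<Rightarrow> ('r, 'l) ring_scheme \<Rightarrow> (int \<Rightarrow> 'r set)
      \<Rightarrow> ('r, 'v, 'm) module_scheme \<Rightarrow> (int \<Rightarrow> 'v set) \<Rightarrow> nat
      \<Rightarrow> int \<Rightarrow> ('v list \<Rightarrow> 'r) set set" where
  "exterior_part K \<phi> R gr M grM n i =
     module.span K (restrict_scalars \<phi> (exterior_power R M n))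
       {f \<odot>\<^bsub>exterior_power R M n\<^esub> wedge R M xs | f a xs ds.
          f \<in> gr a \<and> length xs = n \<and> length ds = n \<and> (\<forall>j<n. xs ! j \<in> grM (ds ! j)) \<and>
          a + sum_list ds = i}"


section \<open>Hilbert functions, Hilbert polynomials and regularity indices\<close>

definition hilbert_fun ::
    "('k, 'n) ring_scheme \<Rightarrow> ('k \<Rightarrow> 'r) \<Rightarrow> ('r, 'v, 'm) module_scheme \<Rightarrow> (int \<Rightarrow> 'v set)
      \<Rightarrow> int \<Rightarrow> nat" where
  "hilbert_fun K \<phi> M gr i = vectorspace.dim K ((restrict_scalars \<phi> M)\<lparr>carrier := gr i\<rparr>)"

definition is_hilbert_poly :: "(int \<Rightarrow> nat) \<Rightarrow> rat poly \<Rightarrow> bool" where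
  "is_hilbert_poly H p \<longleftrightarrow> (\<exists>N. \<forall>i\<ge>N. of_nat (H i) = poly p (of_int i))"

definition hilbert_poly :: "(int \<Rightarrow> nat) \<Rightarrow> rat poly" where
  "hilbert_poly H = (THE p. is_hilbert_poly H p)"

text \<open>This is a relation because the minimum over all integers need not exist: for the zero
  module every integer qualifies.\<close>

definition is_regularity_index :: "(int \<Rightarrow> nat) \<Rightarrow> int \<Rightarrow> bool" where
  "is_regularity_index H r \<longleftrightarrow>
     (let A = {i. \<forall>j\<ge>i. of_nat (H j) = poly (hilbert_poly H) (of_int j)}
      in r \<in> A \<and> (\<forall>i\<in>A. r \<le> i))"


section \<open>Subschemes of the projective line\<close>

text \<open>The ring \<open>K[X0, X1]\<close> is represented as \<open>K[X0][X1]\<close>, so \<open>coeff (coeff p j) i\<close> is the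
  coefficient of \<open>X0^i X1^j\<close> in \<open>p\<close>.\<close>

abbreviation base_field :: "'k::field_char_0 ring" where
  "base_field \<equiv> ring_of_type_algebra"

abbreviation P1_ring :: "'k::field_char_0 poly poly ring" where
  "P1_ring \<equiv> ring_of_type_algebra"

definition const :: "'k::field_char_0 \<Rightarrow> 'k poly poly" where
  "const c = [:[:c:]:]"

definition X0 :: "'k::field_char_0 poly poly" where
  "X0 = [:[:0, 1:]:]"

definition X1 :: "'k::field_char_0 poly poly" where
  "X1 = [:0, 1:]"

definition forms :: "int \<Rightarrow> 'k::field_char_0 poly poly set" where
  "forms d = {p. \<forall>i j. coeff (coeff p j) i \<noteq> 0 \<longrightarrow> int i + int j = d}"

definition coord_ring :: "'k::field_char_0 poly poly set \<Rightarrow> 'k poly poly set ring" where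
  "coord_ring I = P1_ring Quot I"

definition coord_const :: "'k::field_char_0 poly poly set \<Rightarrow> 'k \<Rightarrow> 'k poly poly set" where
  "coord_const I c = I +>\<^bsub>P1_ring\<^esub> const c"

definition coord_part :: "'k::field_char_0 poly poly set \<Rightarrow> int \<Rightarrow> 'k poly poly set set" where
  "coord_part I i = (\<lambda>p. I +>\<^bsub>P1_ring\<^esub> p) ` forms i"

definition homogeneous_ideal :: "'k::field_char_0 poly poly set \<Rightarrow> bool" where
  "homogeneous_ideal I \<longleftrightarrow> ideal I P1_ring \<and> I = Idl\<^bsub>P1_ring\<^esub> (I \<inter> (\<Union>d. forms d))"

definition saturated :: "'k::field_char_0 poly poly set \<Rightarrow> bool" where
  "saturated I \<longleftrightarrow> (\<forall>p. (\<exists>n. \<forall>q \<in> forms (int n). q * p \<in> I) \<longrightarrow> p \<in> I)"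

definition HF_coord :: "'k::field_char_0 poly poly set \<Rightarrow> int \<Rightarrow> nat" where
  "HF_coord I =
     hilbert_fun base_field (coord_const I) (regular_module (coord_ring I)) (coord_part I)"

text \<open>A closed subscheme of the projective line is represented by its saturated homogeneous
  vanishing ideal. It has dimension 0 iff the Hilbert polynomial of its coordinate ring
  is a nonzero constant.\<close>

definition zero_dim_scheme :: "'k::field_char_0 poly poly set \<Rightarrow> bool" where
  "zero_dim_scheme I \<longleftrightarrow> homogeneous_ideal I \<and> saturated I \<and>
     (\<exists>c>0. is_hilbert_poly (HF_coord I) [:c:])"

definition Omega1 ::
    "'k::field_char_0 poly poly set
      \<Rightarrow> ('k poly poly set, ('k poly poly set \<Rightarrow> 'k poly poly set) set) module" where
  "Omega1 I = kaehler base_field (coord_const I) (coord_ring I)"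

definition Omega1_part ::
    "'k::field_char_0 poly poly set \<Rightarrow> int \<Rightarrow> ('k poly poly set \<Rightarrow> 'k poly poly set) set set" where
  "Omega1_part I = kaehler_part base_field (coord_const I) (coord_ring I) (coord_part I)"

definition HF_Omega1 :: "'k::field_char_0 poly poly set \<Rightarrow> int \<Rightarrow> nat" where
  "HF_Omega1 I = hilbert_fun base_field (coord_const I) (Omega1 I) (Omega1_part I)"

definition HF_Omega :: "'k::field_char_0 poly poly set \<Rightarrow> nat \<Rightarrow> int \<Rightarrow> nat" where
  "HF_Omega I n =
     hilbert_fun base_field (coord_const I) (exterior_power (coord_ring I) (Omega1 I) n)
       (exterior_part base_field (coord_const I) (coord_ring I) (coord_part I)
          (Omega1 I) (Omega1_part I) n)"

end

theory Submission
  imports Defs "Jordan_Normal_Form.VS_Connect" "HOL-Library.Product_Plus"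
begin

text \<open>Write \<open>F0\<close>, \<open>F1\<close> for the partial derivatives of \<open>F\<close> and \<open>S\<close> for the polynomial ring. Then
  \<open>\<Omega>\<^sup>1\<close> is the quotient of \<open>S dx0 \<oplus> S dx1\<close> by \<open>F\<close> times everything and by \<open>S dF\<close>, and \<open>\<Omega>\<^sup>2\<close> is the
  quotient of \<open>S dx0 \<and> dx1\<close> by the ideal \<open>(F0, F1)\<close>, which contains \<open>F\<close> by Euler's formula in
  characteristic zero. So both Hilbert functions follow from the dimensions of the graded pieces of
  these submodules of relations, that is, from their syzygies. Let
  \<open>G = \<Prod> (X1 - a i X0) ^ (m i - 1)\<close>. Then \<open>F = G P\<close>, \<open>F0 = G A\<close> and \<open>F1 = G B\<close>, where \<open>P\<close> has
  degree \<open>s\<close>, and \<open>A\<close> and \<open>B\<close> have degree \<open>s - 1\<close>. As \<open>B\<close> vanishes at none of the simple roots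
  of \<open>P\<close>, the syzygies of \<open>(F0, F1)\<close> are generated by \<open>(B, - A)\<close>, and the relations among \<open>dF\<close>,
  \<open>F dx0\<close>, \<open>F dx1\<close> by \<open>(P, - A, - B)\<close>.\<close>

section \<open>Dimensions of vector spaces\<close>

text \<open>The delicate claim is that \<Omega>^1 and \<Omega>^2 satisfy no relations beyond the
  listed ones. Both are presented by a symbol for every element, or every pair of elements, of a
  quotient, so a candidate relation can be refuted only by a map out of these presentations. Its
  natural values are gradients and 2x2 minors, but these need a polynomial for each residue class
  and coordinates for each differential. Such choices respect the operations only modulo
  \<open>F\<close>, respectively modulo the relations of \<Omega>^1. Evaluation therefore takes
  place among polynomials or pairs of polynomials, and every law is asked for only modulo the
  relations in question. For the syzygies, Euler's formula takes the place of gcd theory in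
  K[X0, X1]: it turns a syzygy of the two partial derivatives into a divisibility by
  \<open>P\<close>, which can be tested by substituting elements of K[X0] for X1.\<close>

lemma field_base_field: "field (base_field :: 'k::field_char_0 ring)"
  by (rule field_from_type_algebra)

lemma base_field_simps [simp]:
  "carrier (base_field :: 'k::field_char_0 ring) = UNIV"
  "\<zero>\<^bsub>base_field :: 'k ring\<^esub> = 0" "\<one>\<^bsub>base_field :: 'k ring\<^esub> = 1"
  "a \<oplus>\<^bsub>base_field\<^esub> b = a + b" "a \<otimes>\<^bsub>base_field\<^esub> b = a * (b :: 'k)"
  by (simp_all add: ring_of_type_algebra_def)

lemma linear_mapI:
  assumes "vectorspace K V" "vectorspace K W"
    and "\<And>v. v \<in> carrier V \<Longrightarrow> T v \<in> carrier W"
    and "\<And>v w. v \<in> carrier V \<Longrightarrow> w \<in> carrier V \<Longrightarrow> T (v \<oplus>\<^bsub>V\<^esub> w) = T v \<oplus>\<^bsub>W\<^esub> T w"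
    and "\<And>c v. c \<in> carrier K \<Longrightarrow> v \<in> carrier V \<Longrightarrow> T (c \<odot>\<^bsub>V\<^esub> v) = c \<odot>\<^bsub>W\<^esub> T v"
  shows "linear_map K V W T"
  using assms
  by (auto simp: linear_map_def mod_hom_def mod_hom_axioms_def module_hom_def vectorspace_def)

lemma dim_zero_space:
  fixes V :: "('a, 'b, 'c) module_scheme"
  assumes "vectorspace K V"
  shows "vectorspace.dim K (V\<lparr>carrier := {\<zero>\<^bsub>V\<^esub>}\<rparr>) = 0"
proof -
  interpret V: vectorspace K V by fact
  let ?Z = "V\<lparr>carrier := {\<zero>\<^bsub>V\<^esub>}\<rparr>"
  have "subspace K {\<zero>\<^bsub>V\<^esub>} V"
    using assms by (auto simp: subspace_def submodule_def vectorspace_def)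
  then interpret Z: vectorspace K ?Z by (rule V.subspace_is_vs)
  have "Z.span {} = {\<zero>\<^bsub>V\<^esub>}"
    by (auto simp: Z.span_def Z.lincomb_def)
  then have "Z.dim \<le> card ({} :: 'b set)"
    by (intro Z.gen_ge_dim) simp_all
  then show ?thesis by simp
qed

text \<open>Rank-nullity for \<open>T\<close> leaves the dimension of its kernel, and rank-nullity
  for the injective \<open>S\<close> identifies that with the dimension of \<open>U\<close>. It is
  used twice over: for relations modulo their syzygies, and for a graded piece modulo its
  relations.\<close>

lemma dim_exact:
  assumes T: "linear_map K V W T" and V: "vectorspace.fin_dim K V"
    and surj: "T ` carrier V = carrier W"
    and S: "linear_map K U V S" and U: "vectorspace.fin_dim K U"
    and inj: "inj_on S (carrier U)"
    and exact: "S ` carrier U = {v \<in> carrier V. T v = \<zero>\<^bsub>W\<^esub>}"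
  shows "vectorspace.fin_dim K W"
    and "vectorspace.dim K W + vectorspace.dim K U = vectorspace.dim K V"
proof -
  interpret T: linear_map K V W T by fact
  interpret S: linear_map K U V S by fact
  show "vectorspace.fin_dim K W"
    using V surj by (rule T.rank_nullity_main(2))
  have 1: "vectorspace.dim K W + vectorspace.dim K (V\<lparr>carrier := T.kerT\<rparr>) = vectorspace.dim K V"
    using T.rank_nullity[OF V] T.surj_imp_imT_carrier[OF surj] by simp
  have kerT: "T.kerT = S.imT" using exact by (auto simp: T.ker_def S.im_def)
  have "S.kerT = {\<zero>\<^bsub>U\<^esub>}"
    using inj_onD[OF inj, of _ "\<zero>\<^bsub>U\<^esub>"] S.T0_is_0 S.M.zero_closed unfolding S.ker_def by auto
  then have "vectorspace.dim K (V\<lparr>carrier := S.imT\<rparr>) = vectorspace.dim K U"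
    using S.rank_nullity[OF U] dim_zero_space[of K U] S.V.vectorspace_axioms by simp
  with 1 kerT show "vectorspace.dim K W + vectorspace.dim K U = vectorspace.dim K V" by simp
qed

text \<open>Bridges two styles: polynomials and tuples of them live in type classes, while the
  dimension theory is stated for records with a carrier.\<close>

definition vsp :: "('k \<Rightarrow> 'v::ab_group_add \<Rightarrow> 'v) \<Rightarrow> 'v set \<Rightarrow> ('k, 'v) module" where
  "vsp sc U = \<lparr>carrier = U, monoid.mult = undefined, monoid.one = undefined,
     ring.zero = 0, ring.add = (+), module.smult = sc\<rparr>"

lemma vsp_simps [simp]:
  "carrier (vsp sc U) = U" "\<zero>\<^bsub>vsp sc U\<^esub> = 0" "v \<oplus>\<^bsub>vsp sc U\<^esub> w = v + w"
  "c \<odot>\<^bsub>vsp sc U\<^esub> v = sc c v"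
  by (simp_all add: vsp_def)

lemma vectorspace_vsp:
  fixes sc :: "'k::field_char_0 \<Rightarrow> 'v::ab_group_add \<Rightarrow> 'v"
  assumes "vector_space sc" "module.subspace sc U"
  shows "vectorspace base_field (vsp sc U)"
proof -
  interpret vector_space sc by fact
  show ?thesis
    using assms(2)
    by (intro vs_criteria)
       (auto simp: field_base_field subspace_def scale_right_distrib scale_left_distrib
             intro: bexI[of _ "- x" for x] subspace_neg[OF assms(2)])
qed

definition prod_scale :: "('k \<Rightarrow> 'v \<Rightarrow> 'v) \<Rightarrow> ('k \<Rightarrow> 'w \<Rightarrow> 'w) \<Rightarrow> 'k \<Rightarrow> 'v \<times> 'w \<Rightarrow> 'v \<times> 'w" where
  "prod_scale s t c = map_prod (s c) (t c)"

lemma prod_scale_apply [simp]: "prod_scale s t c (v, w) = (s c v, t c w)"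
  by (simp add: prod_scale_def)

lemma vector_space_prod_scale:
  assumes "vector_space s" "vector_space t"
  shows "vector_space (prod_scale s t)"
proof -
  interpret s: vector_space s by fact
  interpret t: vector_space t by fact
  show ?thesis
    by unfold_locales (auto simp: s.scale_right_distrib s.scale_left_distrib
      t.scale_right_distrib t.scale_left_distrib)
qed

lemma subspace_prod_scale:
  assumes "vector_space s" "vector_space t" "module.subspace s U" "module.subspace t V"
  shows "module.subspace (prod_scale s t) (U \<times> V)"
proof -
  interpret s: vector_space s by fact
  interpret t: vector_space t by fact
  interpret st: vector_space "prod_scale s t" by (rule vector_space_prod_scale) fact+
  show ?thesis using assms(3,4)
    by (auto simp: st.subspace_def s.subspace_def t.subspace_def zero_prod_def)
qed

text \<open>An explicit isomorphism with the vectors of length \<open>n\<close>, instead of a bare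
  dimension: it yields finite dimension and the dimension at once, and products are handled by
  concatenating vectors.\<close>

definition coord_space :: "('k::field_char_0, 'v) module \<Rightarrow> nat \<Rightarrow> bool" where
  "coord_space V n \<longleftrightarrow> vectorspace base_field V \<and>
     (\<exists>T. linear_map base_field (module_vec TYPE('k) n) V T \<and> bij_betw T (carrier_vec n) (carrier V))"

lemma coord_space_dim:
  fixes V :: "('k::field_char_0, 'v) module"
  assumes "coord_space V n"
  shows "vectorspace.fin_dim base_field V" "vectorspace.dim base_field V = n"
proof -
  obtain T where T: "linear_map base_field (module_vec TYPE('k) n) V T"
    and bij: "bij_betw T (carrier_vec n) (carrier V)"
    using assms by (auto simp: coord_space_def)
  have fd: "vectorspace.fin_dim base_field (module_vec TYPE('k) n)"
    unfolding ring_of_type_algebra_def by (rule vec_space.fin_dim)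
  have dim: "vectorspace.dim base_field (module_vec TYPE('k) n) = n"
    unfolding ring_of_type_algebra_def by (rule vec_space.dim_is_n)
  interpret T: linear_map base_field "module_vec TYPE('k) n" V T by fact
  have surj: "T ` carrier (module_vec TYPE('k) n) = carrier V"
    using bij by (simp add: bij_betw_def module_vec_def)
  show "vectorspace.fin_dim base_field V"
    by (rule T.rank_nullity_main(2)[OF fd surj])
  have inj: "inj_on T (carrier (module_vec TYPE('k) n))"
    using bij by (simp add: bij_betw_def module_vec_def)
  have "T.kerT = {\<zero>\<^bsub>module_vec TYPE('k) n\<^esub>}"
    using inj_onD[OF inj, of _ "\<zero>\<^bsub>module_vec TYPE('k) n\<^esub>"] T.T0_is_0 T.M.zero_closed
    unfolding T.ker_def by auto
  then show "vectorspace.dim base_field V = n"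
    using T.rank_nullity[OF fd] dim_zero_space[OF T.V.vectorspace_axioms]
      T.surj_imp_imT_carrier[OF surj] dim by simp
qed

lemma coord_space_prod:
  fixes s :: "'k::field_char_0 \<Rightarrow> 'v::ab_group_add \<Rightarrow> 'v" and t :: "'k \<Rightarrow> 'w::ab_group_add \<Rightarrow> 'w"
  assumes vs: "vector_space s" "vector_space t" "module.subspace s U" "module.subspace t V"
    and "coord_space (vsp s U) n" "coord_space (vsp t V) m"
  shows "coord_space (vsp (prod_scale s t) (U \<times> V)) (n + m)"
proof -
  obtain S where S: "linear_map base_field (module_vec TYPE('k) n) (vsp s U) S"
    and bS: "bij_betw S (carrier_vec n) U"
    using assms by (auto simp: coord_space_def)
  obtain T where T: "linear_map base_field (module_vec TYPE('k) m) (vsp t V) T"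
    and bT: "bij_betw T (carrier_vec m) V"
    using assms by (auto simp: coord_space_def)
  interpret S: linear_map base_field "module_vec TYPE('k) n" "vsp s U" S by fact
  interpret T: linear_map base_field "module_vec TYPE('k) m" "vsp t V" T by fact
  note sp = subspace_prod_scale[OF vs] and vsp = vector_space_prod_scale[OF vs(1,2)]
  have vs: "vectorspace base_field (vsp (prod_scale s t) (U \<times> V))"
    by (rule vectorspace_vsp[OF vsp sp])
  define R where "R = (\<lambda>v. (S (vec_first v n), T (vec_last v m)))"
  have first_add: "vec_first (v + w) n = vec_first v n + vec_first w n"
    and last_add: "vec_last (v + w) m = vec_last v m + vec_last w m"
    and first_smult: "vec_first (c \<cdot>\<^sub>v v) n = c \<cdot>\<^sub>v vec_first v n"
    and last_smult: "vec_last (c \<cdot>\<^sub>v v) m = c \<cdot>\<^sub>v vec_last v m"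
    if "v \<in> carrier_vec (n + m)" "w \<in> carrier_vec (n + m)" for v w :: "'k vec" and c
    using that by (auto simp: vec_first_def vec_last_def)
  have lin: "linear_map base_field (module_vec TYPE('k) (n + m)) (vsp (prod_scale s t) (U \<times> V)) R"
    using S.T_add T.T_add S.T_smult T.T_smult S.T_im T.T_im
    by (intro linear_mapI vs)
       (auto simp: R_def module_vec_simps first_add last_add first_smult last_smult
         ring_of_type_algebra_def vec_vs)
  have bij: "bij_betw R (carrier_vec (n + m)) (U \<times> V)"
  proof (rule bij_betwI')
    fix v w :: "'k vec" assume v: "v \<in> carrier_vec (n + m)" and w: "w \<in> carrier_vec (n + m)"
    show "R v = R w \<longleftrightarrow> v = w"
    proof
      assume "R v = R w"
      then have "vec_first v n = vec_first w n" "vec_last v m = vec_last w m"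
        using bS bT by (auto simp: R_def bij_betw_def dest!: inj_onD)
      then show "v = w" using vec_first_last_append v w by metis
    qed simp
  next
    fix v :: "'k vec" assume "v \<in> carrier_vec (n + m)"
    show "R v \<in> U \<times> V" using bS bT by (auto simp: R_def bij_betw_def)
  next
    fix p assume "p \<in> U \<times> V"
    then obtain a b where ab: "a \<in> carrier_vec n" "b \<in> carrier_vec m" "p = (S a, T b)"
      using bS bT by (fastforce simp: bij_betw_def image_iff)
    then have "vec_first (a @\<^sub>v b) n = a" "vec_last (a @\<^sub>v b) m = b"
      by (auto simp: vec_first_def vec_last_def)
    then show "\<exists>v\<in>carrier_vec (n + m). p = R v"
      using ab by (intro bexI[of _ "a @\<^sub>v b"]) (auto simp: R_def)
  qed
  show ?thesis
    unfolding coord_space_def vsp_simps by (rule conjI, rule vs, rule exI[of _ R], rule conjI, rule lin, rule bij)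
qed

section \<open>Free modules and quotient modules\<close>

lemma submodule_a_inv_closed:
  assumes "submodule R N M" "x \<in> N"
  shows "\<ominus>\<^bsub>M\<^esub> x \<in> N"
proof -
  interpret submodule R N M by fact
  interpret M: Module.module R M by (rule module)
  have "x \<in> carrier M" using assms(2) subset by blast
  then have "\<ominus>\<^bsub>M\<^esub> x = (\<ominus>\<^bsub>R\<^esub> \<one>\<^bsub>R\<^esub>) \<odot>\<^bsub>M\<^esub> x" by (simp add: M.smult_l_minus)
  then show ?thesis using assms(2) by auto
qed

lemma submodule_abelian_subgroup:
  assumes "submodule R N M"
  shows "abelian_subgroup N M"
proof -
  interpret submodule R N M by fact
  interpret M: Module.module R M by (rule module)
  have "subgroup N (add_monoid M)"
    using subset submodule_a_inv_closed[OF assms]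
    by (intro subgroup.intro) (auto simp: a_inv_def[symmetric])
  then show ?thesis
    by (intro abelian_subgroupI3 M.abelian_group_axioms additive_subgroup.intro)
qed

locale module_quotient = Module.module R M + submodule R N M for R M N
begin

sublocale quot: abelian_subgroup N M
  by (rule submodule_abelian_subgroup[OF submodule_axioms])

abbreviation "Q \<equiv> quot_module M N"

abbreviation cls where "cls x \<equiv> N +>\<^bsub>M\<^esub> x"

lemma carrier_Q: "carrier Q = cls ` carrier M"
  by (auto simp: quot_module_def A_RCOSETS_def RCOSETS_def a_r_coset_def)

lemma cls_eq_iff:
  assumes "x \<in> carrier M" "y \<in> carrier M"
  shows "cls x = cls y \<longleftrightarrow> x \<ominus>\<^bsub>M\<^esub> y \<in> N"
proof
  assume "cls x = cls y"
  moreover have "x \<in> cls x"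
    using assms(1) by (rule quot.a_rcos_self)
  ultimately show "x \<ominus>\<^bsub>M\<^esub> y \<in> N" using quot.a_rcos_module_imp[of y x] assms
    by (auto simp: a_minus_def)
next
  assume "x \<ominus>\<^bsub>M\<^esub> y \<in> N"
  then have "x \<in> cls y" using quot.a_rcos_module_rev[of y x] assms by (simp add: a_minus_def)
  then show "cls x = cls y" using quot.a_repr_independence'[of x y] assms by simp
qed

lemma cls_eq_zero_iff: "x \<in> carrier M \<Longrightarrow> cls x = \<zero>\<^bsub>Q\<^esub> \<longleftrightarrow> x \<in> N"
  using cls_eq_iff[of x "\<zero>\<^bsub>M\<^esub>"] M.a_coset_add_zero[OF subset]
    M.minus_equality[of "\<zero>\<^bsub>M\<^esub>" "\<zero>\<^bsub>M\<^esub>"]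
  by (simp add: quot_module_def a_minus_def)

lemma cls_zero: "cls \<zero>\<^bsub>M\<^esub> = \<zero>\<^bsub>Q\<^esub>"
  by (simp add: cls_eq_zero_iff)

lemma cls_add:
  "x \<in> carrier M \<Longrightarrow> y \<in> carrier M \<Longrightarrow> cls x \<oplus>\<^bsub>Q\<^esub> cls y = cls (x \<oplus>\<^bsub>M\<^esub> y)"
  by (simp add: quot_module_def quot.a_rcos_sum)

text \<open>In \<open>quot_module\<close> a scalar multiple is the union of the cosets obtained from
  all members of the given coset. These cosets coincide because \<open>N\<close> is closed under
  scalars, and there is at least one.\<close>

lemma cls_smult:
  assumes "r \<in> carrier R" "x \<in> carrier M"
  shows "r \<odot>\<^bsub>Q\<^esub> cls x = cls (r \<odot>\<^bsub>M\<^esub> x)"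
proof -
  have "cls (r \<odot>\<^bsub>M\<^esub> y) = cls (r \<odot>\<^bsub>M\<^esub> x)" if y: "y \<in> cls x" for y
  proof -
    have yc: "y \<in> carrier M" using y assms M.a_r_coset_subset_G[OF subset] by blast
    have "cls y = cls x" using quot.a_repr_independence'[OF y assms(2)] by simp
    then have "y \<ominus>\<^bsub>M\<^esub> x \<in> N" using cls_eq_iff yc assms by simp
    then have "r \<odot>\<^bsub>M\<^esub> (y \<ominus>\<^bsub>M\<^esub> x) \<in> N" using assms by simp
    then show ?thesis using cls_eq_iff yc assms
      by (simp add: a_minus_def smult_r_distr smult_r_minus)
  qed
  then have "(\<Union>y\<in>cls x. cls (r \<odot>\<^bsub>M\<^esub> y)) = (\<Union>y\<in>cls x. cls (r \<odot>\<^bsub>M\<^esub> x))"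
    by (intro SUP_cong refl)
  moreover have "cls x \<noteq> {}" using quot.a_rcos_self[OF assms(2)] by blast
  ultimately show ?thesis by (simp add: quot_module_def)
qed

lemma module_Q: "Module.module R Q"
proof (rule module_criteria)
  show "\<forall>v\<in>carrier Q. \<exists>neg_v\<in>carrier Q. v \<oplus>\<^bsub>Q\<^esub> neg_v = \<zero>\<^bsub>Q\<^esub>"
  proof
    fix v assume "v \<in> carrier Q"
    then obtain x where "x \<in> carrier M" "v = cls x" by (auto simp: carrier_Q)
    then show "\<exists>neg_v\<in>carrier Q. v \<oplus>\<^bsub>Q\<^esub> neg_v = \<zero>\<^bsub>Q\<^esub>"
      by (intro bexI[of _ "cls (\<ominus>\<^bsub>M\<^esub> x)"]) (auto simp: carrier_Q cls_add cls_zero M.r_neg)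
  qed
  show "\<zero>\<^bsub>Q\<^esub> \<in> carrier Q" using cls_zero by (force simp: carrier_Q)
  show "\<forall>v\<in>carrier Q. v \<oplus>\<^bsub>Q\<^esub> \<zero>\<^bsub>Q\<^esub> = v"
    by (auto simp: carrier_Q cls_add cls_zero[symmetric])
  show "\<forall>v w x. v \<in> carrier Q \<and> w \<in> carrier Q \<and> x \<in> carrier Q \<longrightarrow>
      v \<oplus>\<^bsub>Q\<^esub> w \<oplus>\<^bsub>Q\<^esub> x = v \<oplus>\<^bsub>Q\<^esub> (w \<oplus>\<^bsub>Q\<^esub> x)"
    by (auto simp: carrier_Q cls_add M.a_assoc)
  show "\<forall>v w. v \<in> carrier Q \<and> w \<in> carrier Q \<longrightarrow> v \<oplus>\<^bsub>Q\<^esub> w = w \<oplus>\<^bsub>Q\<^esub> v"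
    by (auto simp: carrier_Q cls_add M.a_comm)
qed (auto simp: carrier_Q cls_add cls_smult smult_assoc1 smult_l_distr smult_r_distr is_cring)

end

lemma module_free_module:
  fixes R (structure)
  assumes "cring R"
  shows "Module.module R (free_module R B)"
proof -
  interpret cring R by fact
  have fin: "finite {x. f x \<oplus> g x \<noteq> \<zero>}"
    if "finite {x. f x \<noteq> \<zero>}" "finite {x. g x \<noteq> \<zero>}" for f g :: "'c \<Rightarrow> 'a"
    by (rule finite_subset[OF _ finite_UnI[OF that]]) auto
  have fin2: "finite {x. r \<otimes> f x \<noteq> \<zero>}"
    if "finite {x. f x \<noteq> \<zero>}" "r \<in> carrier R" for f :: "'c \<Rightarrow> 'a" and r
    by (rule finite_subset[OF _ that(1)]) (use that(2) in auto)
  have fin3: "finite {x. \<ominus> f x \<noteq> \<zero>}"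
    if "finite {x. f x \<noteq> \<zero>}" for f :: "'c \<Rightarrow> 'a"
    by (rule finite_subset[OF _ that]) auto
  show ?thesis
  proof (rule module_criteria)
    show "\<forall>v\<in>carrier (free_module R B). \<exists>w\<in>carrier (free_module R B).
        v \<oplus>\<^bsub>free_module R B\<^esub> w = \<zero>\<^bsub>free_module R B\<^esub>"
    proof
      fix v assume "v \<in> carrier (free_module R B)"
      then show "\<exists>w\<in>carrier (free_module R B). v \<oplus>\<^bsub>free_module R B\<^esub> w = \<zero>\<^bsub>free_module R B\<^esub>"
        by (intro bexI[of _ "\<lambda>x. \<ominus> v x"]) (auto simp: free_module_def fin3 r_neg)
    qed
  qed (auto simp: free_module_def fin fin2 is_cring a_ac m_assoc l_distr r_distr)
qed

lemma free_gen_closed: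
  fixes R (structure)
  assumes "cring R" "x \<in> B"
  shows "free_gen R x \<in> carrier (free_module R B)"
proof -
  interpret cring R by fact
  have "{y. free_gen R x y \<noteq> \<zero>} \<subseteq> {x}" by (auto simp: free_gen_def)
  then have "finite {y. free_gen R x y \<noteq> \<zero>}" by (rule finite_subset) simp
  then show ?thesis using assms(2)
    by (auto simp: free_module_def free_gen_def)
qed

lemma module_restrict_scalars:
  assumes "cring K" "Module.module R M" "\<phi> \<in> Ring.ring_hom K R"
  shows "Module.module K (restrict_scalars \<phi> M)"
proof -
  interpret Module.module R M by fact
  have "\<phi> c \<in> carrier R" if "c \<in> carrier K" for c using assms(3) that by (rule ring_hom_closed)
  moreover have "\<exists>w\<in>carrier M. v \<oplus>\<^bsub>M\<^esub> w = \<zero>\<^bsub>M\<^esub>" if "v \<in> carrier M" for v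
    using that M.r_neg by blast
  ultimately show ?thesis
    using assms(1)
    by (intro module_criteria)
       (auto simp: restrict_scalars_def M.a_ac smult_assoc1 smult_l_distr smult_r_distr
         ring_hom_mult[OF assms(3)] ring_hom_add[OF assms(3)] ring_hom_one[OF assms(3)])
qed

text \<open>A module over \<open>R\<close> only up to the subgroup \<open>N\<close>, such as one on which a quotient ring acts through
  arbitrarily chosen representatives. Evaluating elements of a free module in it (\<open>ev\<close> below) shows that
  an element is not a consequence of given relations, without constructing a homomorphism.\<close>

locale module_mod = cring R for R (structure) +
  fixes act :: "'a \<Rightarrow> 'w::ab_group_add \<Rightarrow> 'w" and N :: "'w set"
  assumes zero_N: "0 \<in> N"
    and diff_N: "v \<in> N \<Longrightarrow> w \<in> N \<Longrightarrow> v - w \<in> N"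
    and act_N: "r \<in> carrier R \<Longrightarrow> w \<in> N \<Longrightarrow> act r w \<in> N"
    and act_add: "act r (v + w) = act r v + act r w"
    and add_act: "r \<in> carrier R \<Longrightarrow> s \<in> carrier R \<Longrightarrow> act (r \<oplus> s) w - (act r w + act s w) \<in> N"
    and mult_act: "r \<in> carrier R \<Longrightarrow> s \<in> carrier R \<Longrightarrow> act (r \<otimes> s) w - act r (act s w) \<in> N"
    and one_act: "act \<one> w - w \<in> N"
begin

lemma uminus_N: "w \<in> N \<Longrightarrow> - w \<in> N"
  using diff_N[OF zero_N, of w] by simp

lemma add_N: "v \<in> N \<Longrightarrow> w \<in> N \<Longrightarrow> v + w \<in> N"
  using diff_N[of v "- w"] uminus_N by simp

lemma sum_N: "(\<And>x. x \<in> A \<Longrightarrow> f x \<in> N) \<Longrightarrow> sum f A \<in> N"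
  by (induction A rule: infinite_finite_induct) (auto simp: zero_N add_N)

definition cong_N :: "'w \<Rightarrow> 'w \<Rightarrow> bool" (infix "\<approx>" 50) where
  "v \<approx> w \<longleftrightarrow> v - w \<in> N"

lemma cong_refl [simp]: "v \<approx> v"
  by (simp add: cong_N_def zero_N)

lemma cong_sym: "v \<approx> w \<Longrightarrow> w \<approx> v"
  using uminus_N by (force simp: cong_N_def)

lemma cong_trans [trans]: "u \<approx> v \<Longrightarrow> v \<approx> w \<Longrightarrow> u \<approx> w"
  using add_N by (force simp: cong_N_def)

lemma cong_add: "v \<approx> w \<Longrightarrow> v' \<approx> w' \<Longrightarrow> v + v' \<approx> w + w'"
  using add_N by (force simp: cong_N_def add_diff_add)

lemma cong_diff: "v \<approx> w \<Longrightarrow> v' \<approx> w' \<Longrightarrow> v - v' \<approx> w - w'"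
  using diff_N[of "v - w" "v' - w'"] by (simp add: cong_N_def algebra_simps)

lemma cong_sum: "(\<And>x. x \<in> A \<Longrightarrow> f x \<approx> g x) \<Longrightarrow> sum f A \<approx> sum g A"
  by (induction A rule: infinite_finite_induct) (auto simp: cong_add)

lemma cong_mem: "v \<approx> w \<Longrightarrow> v \<in> N \<longleftrightarrow> w \<in> N"
  using add_N[of "v - w" w] diff_N[of v "v - w"] by (auto simp: cong_N_def)

lemma act_zero: "act r 0 = 0"
  using act_add[of r 0 0] by simp

lemma act_diff: "act r (v - w) = act r v - act r w"
  using act_add[of r "v - w" w] by simp

lemma act_sum: "act r (sum f A) = (\<Sum>x\<in>A. act r (f x))"
  by (induction A rule: infinite_finite_induct) (auto simp: act_zero act_add)

lemma zero_act: "act \<zero> w \<in> N"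
  using uminus_N[OF add_act[of \<zero> \<zero> w]] by simp

lemma act_cong: "r \<in> carrier R \<Longrightarrow> v \<approx> w \<Longrightarrow> act r v \<approx> act r w"
  using act_N by (simp add: cong_N_def act_diff[symmetric])

definition ev :: "('x \<Rightarrow> 'w) \<Rightarrow> ('x \<Rightarrow> 'a) \<Rightarrow> 'w" where
  "ev t f = (\<Sum>x | f x \<noteq> \<zero>. act (f x) (t x))"

text \<open>\<open>act \<zero> w\<close> need not vanish and merely lies in \<open>N\<close>, so
  summing over more than the support changes the value by an element of \<open>N\<close>. This is
  why all laws for \<open>ev\<close> are congruences.\<close>

lemma ev_superset:
  assumes "finite A" "{x. f x \<noteq> \<zero>} \<subseteq> A"
  shows "ev t f \<approx> (\<Sum>x\<in>A. act (f x) (t x))"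
proof -
  have "(\<Sum>x\<in>A. act (f x) (t x)) = ev t f + (\<Sum>x\<in>A - {x. f x \<noteq> \<zero>}. act (f x) (t x))"
    unfolding ev_def using sum.subset_diff[OF assms(2,1), of "\<lambda>x. act (f x) (t x)"] by (simp add: add.commute)
  moreover have "(\<Sum>x\<in>A - {x. f x \<noteq> \<zero>}. act (f x) (t x)) \<in> N"
    by (intro sum_N) (auto simp: zero_act)
  ultimately show ?thesis using uminus_N by (simp add: cong_N_def)
qed

lemma ev_zero: "ev t (\<lambda>x. \<zero>) = 0"
  by (simp add: ev_def)

lemma ev_add:
  assumes "f \<in> carrier (free_module R B)" "g \<in> carrier (free_module R B)"
  shows "ev t (f \<oplus>\<^bsub>free_module R B\<^esub> g) \<approx> ev t f + ev t g"
proof -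
  let ?A = "{x. f x \<noteq> \<zero>} \<union> {x. g x \<noteq> \<zero>}"
  have A: "finite ?A" using assms by (auto simp: free_module_def)
  have car: "f x \<in> carrier R" "g x \<in> carrier R" for x
    using assms by (auto simp: free_module_def)
  have "ev t (f \<oplus>\<^bsub>free_module R B\<^esub> g) \<approx> (\<Sum>x\<in>?A. act (f x \<oplus> g x) (t x))"
    by (rule cong_trans[OF ev_superset[OF A]]) (auto simp: free_module_def)
  also have "\<dots> \<approx> (\<Sum>x\<in>?A. act (f x) (t x) + act (g x) (t x))"
    by (intro cong_sum) (use add_act car in \<open>auto simp: cong_N_def\<close>)
  also have "\<dots> = (\<Sum>x\<in>?A. act (f x) (t x)) + (\<Sum>x\<in>?A. act (g x) (t x))"
    by (rule sum.distrib)
  also have "\<dots> \<approx> ev t f + ev t g"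
    by (rule cong_add; rule cong_sym, rule ev_superset[OF A]) blast+
  finally show ?thesis .
qed

lemma ev_smult:
  assumes "r \<in> carrier R" "f \<in> carrier (free_module R B)"
  shows "ev t (r \<odot>\<^bsub>free_module R B\<^esub> f) \<approx> act r (ev t f)"
proof -
  let ?A = "{x. f x \<noteq> \<zero>}"
  have A: "finite ?A" using assms by (auto simp: free_module_def)
  have car: "f x \<in> carrier R" for x
    using assms by (auto simp: free_module_def)
  have "ev t (r \<odot>\<^bsub>free_module R B\<^esub> f) \<approx> (\<Sum>x\<in>?A. act (r \<otimes> f x) (t x))"
    by (rule cong_trans[OF ev_superset[OF A]]) (use assms(1) in \<open>auto simp: free_module_def\<close>)
  also have "\<dots> \<approx> (\<Sum>x\<in>?A. act r (act (f x) (t x)))"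
    by (intro cong_sum) (use mult_act car assms(1) in \<open>auto simp: cong_N_def\<close>)
  also have "\<dots> = act r (ev t f)" by (simp add: ev_def act_sum)
  finally show ?thesis .
qed

text \<open>Derived from additivity by writing \<open>f\<close> as (f - g) + g, since the axioms
  give no law for negated scalars.\<close>

lemma ev_minus:
  assumes "f \<in> carrier (free_module R B)" "g \<in> carrier (free_module R B)"
  shows "ev t (f \<ominus>\<^bsub>free_module R B\<^esub> g) \<approx> ev t f - ev t g"
proof -
  interpret L: Module.module R "free_module R B" by (rule module_free_module[OF is_cring])
  let ?h = "f \<ominus>\<^bsub>free_module R B\<^esub> g"
  have "?h \<oplus>\<^bsub>free_module R B\<^esub> g = f"
    using assms by (simp add: a_minus_def L.a_assoc L.l_neg)
  then have "ev t f \<approx> ev t ?h + ev t g"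
    using ev_add[of ?h B g t] assms by simp
  from cong_diff[OF this cong_refl[of "ev t g"]] show ?thesis by (auto intro: cong_sym)
qed

lemma ev_free_gen: "ev t (free_gen R x) \<approx> t x"
proof -
  have "ev t (free_gen R x) \<approx> (\<Sum>y\<in>{x}. act (free_gen R x y) (t y))"
    by (intro ev_superset) (auto simp: free_gen_def)
  also have "\<dots> \<approx> t x" using one_act by (simp add: free_gen_def cong_N_def)
  finally show ?thesis .
qed

lemma submodule_ev: "submodule R {f \<in> carrier (free_module R B). ev t f \<in> N} (free_module R B)"
proof -
  interpret L: Module.module R "free_module R B" by (rule module_free_module[OF is_cring])
  show ?thesis
  proof (rule submodule.intro)
    fix f g assume "f \<in> {f \<in> carrier (free_module R B). ev t f \<in> N}"
      "g \<in> {f \<in> carrier (free_module R B). ev t f \<in> N}"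
    then show "f \<oplus>\<^bsub>free_module R B\<^esub> g \<in> {f \<in> carrier (free_module R B). ev t f \<in> N}"
      using cong_mem[OF ev_add[of f B g t]] add_N by auto
  next
    fix r f assume "r \<in> carrier R" "f \<in> {f \<in> carrier (free_module R B). ev t f \<in> N}"
    then show "r \<odot>\<^bsub>free_module R B\<^esub> f \<in> {f \<in> carrier (free_module R B). ev t f \<in> N}"
      using cong_mem[OF ev_smult[of r f B t]] act_N by auto
  next
    have "\<zero>\<^bsub>free_module R B\<^esub> = (\<lambda>x. \<zero>)" by (simp add: free_module_def)
    then show "\<zero>\<^bsub>free_module R B\<^esub> \<in> {f \<in> carrier (free_module R B). ev t f \<in> N}"
      using L.M.zero_closed zero_N by (simp add: ev_zero)
  qed (auto simp: L.module_axioms)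
qed

text \<open>The elements whose value lies in \<open>N\<close> form a submodule, so it is enough to
  test generators.\<close>

lemma ev_span:
  assumes "\<And>f. f \<in> A \<Longrightarrow> f \<in> carrier (free_module R B) \<and> ev t f \<in> N"
    and "f \<in> LinearCombinations.module.span R (free_module R B) A"
  shows "ev t f \<in> N"
proof -
  interpret L: Module.module R "free_module R B" by (rule module_free_module[OF is_cring])
  have "L.span A \<subseteq> {f \<in> carrier (free_module R B). ev t f \<in> N}"
    using assms(1) by (intro L.span_is_subset submodule_ev) auto
  then show ?thesis using assms(2) by auto
qed

end

section \<open>Kaehler differentials and exterior squares\<close>

locale algebra_hom = K: cring K + R: cring R for K R +
  fixes \<phi>
  assumes hom: "\<phi> \<in> Ring.ring_hom K R"
begin

abbreviation "L \<equiv> free_module R (carrier R)"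
abbreviation "\<Omega> \<equiv> kaehler K \<phi> R"
abbreviation "d \<equiv> kaehler_d K \<phi> R"

lemma phi_closed: "c \<in> carrier K \<Longrightarrow> \<phi> c \<in> carrier R"
  using hom by (rule ring_hom_closed)

sublocale L: Module.module R L
  by (rule module_free_module[OF R.is_cring])

lemma gen_closed [simp]: "r \<in> carrier R \<Longrightarrow> free_gen R r \<in> carrier L"
  by (rule free_gen_closed[OF R.is_cring])

lemma kaehler_rels_closed: "kaehler_rels K \<phi> R \<subseteq> carrier L"
  by (auto simp: kaehler_rels_def Let_def phi_closed)

sublocale quot: module_quotient R L "kaehler_submodule K \<phi> R"
  unfolding module_quotient_def kaehler_submodule_def
  by (intro conjI L.module_axioms L.span_is_submodule kaehler_rels_closed)

lemma kaehler_eq: "\<Omega> = quot_module L (kaehler_submodule K \<phi> R)"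
  by (simp add: kaehler_def)

sublocale \<Omega>: Module.module R \<Omega>
  unfolding kaehler_eq by (rule quot.module_Q)

lemma d_eq: "d r = quot.cls (free_gen R r)"
  by (simp add: kaehler_d_def)

lemma d_closed [simp]: "r \<in> carrier R \<Longrightarrow> d r \<in> carrier \<Omega>"
  by (auto simp: kaehler_eq quot.carrier_Q d_eq)

lemma rel_mem: "x \<in> kaehler_rels K \<phi> R \<Longrightarrow> x \<in> kaehler_submodule K \<phi> R"
  using L.in_own_span[OF kaehler_rels_closed] by (auto simp: kaehler_submodule_def)

lemma d_add:
  assumes "r \<in> carrier R" "s \<in> carrier R"
  shows "d (r \<oplus>\<^bsub>R\<^esub> s) = d r \<oplus>\<^bsub>\<Omega>\<^esub> d s"
proof -
  have "free_gen R (r \<oplus>\<^bsub>R\<^esub> s) \<ominus>\<^bsub>L\<^esub> (free_gen R r \<oplus>\<^bsub>L\<^esub> free_gen R s) \<in> kaehler_submodule K \<phi> R"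
    by (rule rel_mem) (use assms in \<open>auto simp: kaehler_rels_def Let_def\<close>)
  then show ?thesis using assms by (simp add: d_eq kaehler_eq quot.cls_add quot.cls_eq_iff)
qed

lemma d_mult:
  assumes "r \<in> carrier R" "s \<in> carrier R"
  shows "d (r \<otimes>\<^bsub>R\<^esub> s) = r \<odot>\<^bsub>\<Omega>\<^esub> d s \<oplus>\<^bsub>\<Omega>\<^esub> s \<odot>\<^bsub>\<Omega>\<^esub> d r"
proof -
  have "free_gen R (r \<otimes>\<^bsub>R\<^esub> s) \<ominus>\<^bsub>L\<^esub> (r \<odot>\<^bsub>L\<^esub> free_gen R s \<oplus>\<^bsub>L\<^esub> s \<odot>\<^bsub>L\<^esub> free_gen R r) \<in> kaehler_submodule K \<phi> R"
    by (rule rel_mem) (use assms in \<open>auto simp: kaehler_rels_def Let_def\<close>)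
  then show ?thesis using assms
    by (simp add: d_eq kaehler_eq quot.cls_add quot.cls_smult quot.cls_eq_iff)
qed

lemma d_const:
  assumes "c \<in> carrier K"
  shows "d (\<phi> c) = \<zero>\<^bsub>\<Omega>\<^esub>"
proof -
  have "free_gen R (\<phi> c) \<in> kaehler_submodule K \<phi> R"
    by (rule rel_mem) (use assms in \<open>auto simp: kaehler_rels_def Let_def\<close>)
  then show ?thesis using assms by (simp add: d_eq kaehler_eq quot.cls_eq_zero_iff phi_closed)
qed

end

section \<open>Evaluation of the relations of differentials and exterior powers\<close>

context module_mod
begin

lemma ev_free_gen_mem: "t x \<in> N \<Longrightarrow> ev t (free_gen R x) \<in> N"
  by (simp add: cong_mem[OF ev_free_gen])

lemma ev_add_cong:
  assumes "f \<in> carrier (free_module R B)" "g \<in> carrier (free_module R B)"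
    and "ev t f \<approx> v" "ev t g \<approx> w"
  shows "ev t (f \<oplus>\<^bsub>free_module R B\<^esub> g) \<approx> v + w"
  using cong_trans[OF ev_add[OF assms(1,2)] cong_add[OF assms(3,4)]] .

lemma ev_smult_cong:
  assumes "r \<in> carrier R" "f \<in> carrier (free_module R B)" "ev t f \<approx> v"
  shows "ev t (r \<odot>\<^bsub>free_module R B\<^esub> f) \<approx> act r v"
  using cong_trans[OF ev_smult[OF assms(1,2)] act_cong[OF assms(1,3)]] .

lemma ev_minus_mem:
  assumes "f \<in> carrier (free_module R B)" "g \<in> carrier (free_module R B)"
    and "ev t f \<approx> v" "ev t g \<approx> w" "v \<approx> w"
  shows "ev t (f \<ominus>\<^bsub>free_module R B\<^esub> g) \<in> N"
proof -
  have "ev t (f \<ominus>\<^bsub>free_module R B\<^esub> g) \<approx> v - w"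
    using cong_trans[OF ev_minus[OF assms(1,2)] cong_diff[OF assms(3,4)]] .
  moreover have "v - w \<in> N" using assms(5) by (simp add: cong_N_def)
  ultimately show ?thesis by (simp add: cong_mem)
qed

text \<open>The half of the universal property that bounds the differentials from below: a
  derivation modulo \<open>N\<close> that kills constants is compatible with every consequence of
  the defining relations.\<close>

lemma ev_kaehler_submodule:
  assumes "algebra_hom K R \<phi>"
    and add: "\<And>r s. r \<in> carrier R \<Longrightarrow> s \<in> carrier R \<Longrightarrow> t (r \<oplus> s) \<approx> t r + t s"
    and mult: "\<And>r s. r \<in> carrier R \<Longrightarrow> s \<in> carrier R \<Longrightarrow> t (r \<otimes> s) \<approx> act r (t s) + act s (t r)"
    and const: "\<And>c. c \<in> carrier K \<Longrightarrow> t (\<phi> c) \<in> N"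
    and f: "f \<in> kaehler_submodule K \<phi> R"
  shows "ev t f \<in> N"
proof -
  interpret algebra_hom K R \<phi> by fact
  have add': "ev t (free_gen R (r \<oplus> s) \<ominus>\<^bsub>L\<^esub> (free_gen R r \<oplus>\<^bsub>L\<^esub> free_gen R s)) \<in> N"
    if rs: "r \<in> carrier R" "s \<in> carrier R" for r s
    by (rule ev_minus_mem[OF _ _ ev_free_gen[of t] ev_add_cong[OF _ _ ev_free_gen[of t] ev_free_gen[of t]] add[OF rs]])
      (use rs in simp_all)
  have mult': "ev t (free_gen R (r \<otimes> s) \<ominus>\<^bsub>L\<^esub> (r \<odot>\<^bsub>L\<^esub> free_gen R s \<oplus>\<^bsub>L\<^esub> s \<odot>\<^bsub>L\<^esub> free_gen R r)) \<in> N"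
    if rs: "r \<in> carrier R" "s \<in> carrier R" for r s
    by (rule ev_minus_mem[OF _ _ ev_free_gen[of t]
            ev_add_cong[OF _ _ ev_smult_cong[OF _ _ ev_free_gen[of t]] ev_smult_cong[OF _ _ ev_free_gen[of t]]] mult[OF rs]])
      (use rs in simp_all)
  have "g \<in> carrier L \<and> ev t g \<in> N" if g: "g \<in> kaehler_rels K \<phi> R" for g
  proof
    show "g \<in> carrier L" using g kaehler_rels_closed by blast
    show "ev t g \<in> N"
      using g unfolding kaehler_rels_def Let_def
      by (elim UnE CollectE exE conjE) (simp_all add: add' mult' const ev_free_gen_mem)
  qed
  from ev_span[OF this] show ?thesis using f by (simp add: kaehler_submodule_def)
qed

text \<open>The analogue for exterior powers, where \<open>t\<close> only has to be multilinear and
  alternating modulo \<open>N\<close>.\<close>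

lemma ev_exterior_submodule:
  assumes "Module.module R M"
    and add: "\<And>xs i v w. xs \<in> tuples M n \<Longrightarrow> i < n \<Longrightarrow> v \<in> carrier M \<Longrightarrow> w \<in> carrier M \<Longrightarrow>
      t (xs[i := v \<oplus>\<^bsub>M\<^esub> w]) \<approx> t (xs[i := v]) + t (xs[i := w])"
    and smult: "\<And>xs i r v. xs \<in> tuples M n \<Longrightarrow> i < n \<Longrightarrow> r \<in> carrier R \<Longrightarrow> v \<in> carrier M \<Longrightarrow>
      t (xs[i := r \<odot>\<^bsub>M\<^esub> v]) \<approx> act r (t (xs[i := v]))"
    and alt: "\<And>xs. xs \<in> tuples M n \<Longrightarrow> \<not> distinct xs \<Longrightarrow> t xs \<in> N"
    and f: "f \<in> exterior_submodule R M n"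
  shows "ev t f \<in> N"
proof -
  interpret M: Module.module R M by fact
  let ?L = "free_module R (tuples M n)"
  interpret L: Module.module R ?L by (rule module_free_module[OF is_cring])
  have upd: "xs[i := v] \<in> tuples M n" if "xs \<in> tuples M n" "v \<in> carrier M" for xs i v
    using that set_update_subset_insert[of xs i v] by (auto simp: tuples_def)
  have gen: "free_gen R xs \<in> carrier ?L" if "xs \<in> tuples M n" for xs
    using free_gen_closed[OF is_cring that] .
  have "g \<in> carrier ?L \<and> ev t g \<in> N" if g: "g \<in> exterior_rels R M n" for g
  proof -
    consider (add) xs i v w where "xs \<in> tuples M n" "i < n" "v \<in> carrier M" "w \<in> carrier M"
        "g = free_gen R (xs[i := v \<oplus>\<^bsub>M\<^esub> w]) \<ominus>\<^bsub>?L\<^esub> (free_gen R (xs[i := v]) \<oplus>\<^bsub>?L\<^esub> free_gen R (xs[i := w]))"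
      | (smult) xs i r v where "xs \<in> tuples M n" "i < n" "r \<in> carrier R" "v \<in> carrier M"
        "g = free_gen R (xs[i := r \<odot>\<^bsub>M\<^esub> v]) \<ominus>\<^bsub>?L\<^esub> r \<odot>\<^bsub>?L\<^esub> free_gen R (xs[i := v])"
      | (alt) xs where "xs \<in> tuples M n" "\<not> distinct xs" "g = free_gen R xs"
      using g unfolding exterior_rels_def Let_def by blast
    then show ?thesis
    proof cases
      case add
      have "ev t g \<in> N"
        unfolding add(5)
        by (rule ev_minus_mem[OF _ _ ev_free_gen[of t] ev_add_cong[OF _ _ ev_free_gen[of t] ev_free_gen[of t]] assms(2)[OF add(1-4)]])
          (use add in \<open>simp_all add: gen upd\<close>)
      then show ?thesis using add by (simp add: gen upd)
    next
      case smult
      have "ev t g \<in> N"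
        unfolding smult(5)
        by (rule ev_minus_mem[OF _ _ ev_free_gen[of t] ev_smult_cong[OF _ _ ev_free_gen[of t]] assms(3)[OF smult(1-4)]])
          (use smult in \<open>simp_all add: gen upd\<close>)
      then show ?thesis using smult by (simp add: gen upd)
    next
      case alt
      then show ?thesis using assms(4) gen by (simp add: ev_free_gen_mem)
    qed
  qed
  from ev_span[OF this] show ?thesis using f by (simp add: exterior_submodule_def)
qed

end

section \<open>Calculus in the exterior square of a module\<close>

locale exterior_square = Module.module R M for R M
begin

abbreviation "E \<equiv> free_module R (tuples M 2)"
abbreviation "\<Lambda> \<equiv> exterior_power R M 2"

sublocale E: Module.module R E
  by (rule module_free_module[OF is_cring])

lemma tuples_2 [simp]: "[v, w] \<in> tuples M 2 \<longleftrightarrow> v \<in> carrier M \<and> w \<in> carrier M"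
  by (auto simp: tuples_def)

lemma tuples_2E:
  assumes "xs \<in> tuples M 2"
  obtains v w where "xs = [v, w]" "v \<in> carrier M" "w \<in> carrier M"
  using assms by (cases xs; cases "tl xs") (auto simp: tuples_def)

lemma egen_closed [simp]: "v \<in> carrier M \<Longrightarrow> w \<in> carrier M \<Longrightarrow> free_gen R [v, w] \<in> carrier E"
  by (rule free_gen_closed[OF is_cring]) simp

lemma exterior_rels_closed: "exterior_rels R M 2 \<subseteq> carrier E"
proof -
  have upd: "xs[i := v] \<in> tuples M 2" if "xs \<in> tuples M 2" "v \<in> carrier M" for xs i v
    using that set_update_subset_insert[of xs i v] by (auto simp: tuples_def)
  have gen: "free_gen R xs \<in> carrier E" if "xs \<in> tuples M 2" for xs
    using free_gen_closed[OF is_cring that] .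
  show ?thesis
    unfolding exterior_rels_def Let_def by (auto intro!: gen upd)
qed

sublocale quot: module_quotient R E "exterior_submodule R M 2"
  unfolding module_quotient_def exterior_submodule_def
  by (intro conjI E.module_axioms E.span_is_submodule exterior_rels_closed)

lemma exterior_power_eq: "\<Lambda> = quot_module E (exterior_submodule R M 2)"
  by (simp add: exterior_power_def)

sublocale \<Lambda>: Module.module R \<Lambda>
  unfolding exterior_power_eq by (rule quot.module_Q)

definition wedge2 (infixl "\<and>\<^sub>M" 75) where "v \<and>\<^sub>M w = wedge R M [v, w]"

lemma wedge2_eq: "v \<and>\<^sub>M w = quot.cls (free_gen R [v, w])"
  by (simp add: wedge2_def wedge_def numeral_2_eq_2)

lemma wedge2_closed [simp]: "v \<in> carrier M \<Longrightarrow> w \<in> carrier M \<Longrightarrow> v \<and>\<^sub>M w \<in> carrier \<Lambda>"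
  by (auto simp: exterior_power_eq quot.carrier_Q wedge2_eq)

lemma rel_mem: "x \<in> exterior_rels R M 2 \<Longrightarrow> x \<in> exterior_submodule R M 2"
  using E.in_own_span[OF exterior_rels_closed] by (auto simp: exterior_submodule_def)

lemma rel_add:
  "xs \<in> tuples M 2 \<Longrightarrow> i < 2 \<Longrightarrow> v \<in> carrier M \<Longrightarrow> w \<in> carrier M \<Longrightarrow>
    free_gen R (xs[i := v \<oplus>\<^bsub>M\<^esub> w]) \<ominus>\<^bsub>E\<^esub> (free_gen R (xs[i := v]) \<oplus>\<^bsub>E\<^esub> free_gen R (xs[i := w]))
      \<in> exterior_submodule R M 2"
  by (rule rel_mem) (unfold exterior_rels_def Let_def, blast)

lemma rel_smult:
  "xs \<in> tuples M 2 \<Longrightarrow> i < 2 \<Longrightarrow> r \<in> carrier R \<Longrightarrow> v \<in> carrier M \<Longrightarrow>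
    free_gen R (xs[i := r \<odot>\<^bsub>M\<^esub> v]) \<ominus>\<^bsub>E\<^esub> r \<odot>\<^bsub>E\<^esub> free_gen R (xs[i := v])
      \<in> exterior_submodule R M 2"
  by (rule rel_mem) (unfold exterior_rels_def Let_def, blast)

lemma wedge2_add_left:
  assumes "u \<in> carrier M" "v \<in> carrier M" "w \<in> carrier M"
  shows "(u \<oplus>\<^bsub>M\<^esub> v) \<and>\<^sub>M w = (u \<and>\<^sub>M w) \<oplus>\<^bsub>\<Lambda>\<^esub> (v \<and>\<^sub>M w)"
  using assms rel_add[of "[u, w]" 0 u v]
  by (simp add: wedge2_eq exterior_power_eq quot.cls_add quot.cls_eq_iff)

lemma wedge2_add_right:
  assumes "u \<in> carrier M" "v \<in> carrier M" "w \<in> carrier M"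
  shows "w \<and>\<^sub>M (u \<oplus>\<^bsub>M\<^esub> v) = (w \<and>\<^sub>M u) \<oplus>\<^bsub>\<Lambda>\<^esub> (w \<and>\<^sub>M v)"
  using assms rel_add[of "[w, u]" 1 u v]
  by (simp add: wedge2_eq exterior_power_eq quot.cls_add quot.cls_eq_iff)

lemma wedge2_smult_left:
  assumes "r \<in> carrier R" "v \<in> carrier M" "w \<in> carrier M"
  shows "(r \<odot>\<^bsub>M\<^esub> v) \<and>\<^sub>M w = r \<odot>\<^bsub>\<Lambda>\<^esub> (v \<and>\<^sub>M w)"
  using assms rel_smult[of "[v, w]" 0 r v]
  by (simp add: wedge2_eq exterior_power_eq quot.cls_smult quot.cls_eq_iff)

lemma wedge2_smult_right:
  assumes "r \<in> carrier R" "v \<in> carrier M" "w \<in> carrier M"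
  shows "w \<and>\<^sub>M (r \<odot>\<^bsub>M\<^esub> v) = r \<odot>\<^bsub>\<Lambda>\<^esub> (w \<and>\<^sub>M v)"
  using assms rel_smult[of "[w, v]" 1 r v]
  by (simp add: wedge2_eq exterior_power_eq quot.cls_smult quot.cls_eq_iff)

lemma wedge2_self:
  assumes "v \<in> carrier M"
  shows "v \<and>\<^sub>M v = \<zero>\<^bsub>\<Lambda>\<^esub>"
proof -
  have "free_gen R [v, v] \<in> exterior_submodule R M 2"
    by (rule rel_mem) (use assms in \<open>auto simp: exterior_rels_def Let_def\<close>)
  then show ?thesis using assms
    by (simp add: wedge2_eq exterior_power_eq quot.cls_eq_zero_iff)
qed

lemma wedge2_antisym:
  assumes "v \<in> carrier M" "w \<in> carrier M"
  shows "w \<and>\<^sub>M v = \<ominus>\<^bsub>\<Lambda>\<^esub> (v \<and>\<^sub>M w)"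
proof -
  have "\<zero>\<^bsub>\<Lambda>\<^esub> = (v \<oplus>\<^bsub>M\<^esub> w) \<and>\<^sub>M (v \<oplus>\<^bsub>M\<^esub> w)"
    using assms by (simp add: wedge2_self)
  also have "\<dots> = w \<and>\<^sub>M v \<oplus>\<^bsub>\<Lambda>\<^esub> v \<and>\<^sub>M w"
    using assms by (simp add: wedge2_add_left wedge2_add_right wedge2_self[of v] wedge2_self[of w])
  finally show ?thesis using assms by (intro \<Lambda>.minus_equality[symmetric]) auto
qed

text \<open>Of the four terms of the expansion, the two squares vanish and antisymmetry merges the
  other two; the determinant of the coefficients remains.\<close>

lemma wedge2_lincomb:
  assumes "p \<in> carrier R" "q \<in> carrier R" "p' \<in> carrier R" "q' \<in> carrier R"
    and "v \<in> carrier M" "w \<in> carrier M"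
  shows "(p \<odot>\<^bsub>M\<^esub> v \<oplus>\<^bsub>M\<^esub> q \<odot>\<^bsub>M\<^esub> w) \<and>\<^sub>M (p' \<odot>\<^bsub>M\<^esub> v \<oplus>\<^bsub>M\<^esub> q' \<odot>\<^bsub>M\<^esub> w) =
    (p \<otimes>\<^bsub>R\<^esub> q' \<ominus>\<^bsub>R\<^esub> q \<otimes>\<^bsub>R\<^esub> p') \<odot>\<^bsub>\<Lambda>\<^esub> (v \<and>\<^sub>M w)"
  using assms wedge2_antisym[of v w]
  by (simp add: wedge2_add_left wedge2_add_right wedge2_smult_left wedge2_smult_right wedge2_self
    \<Lambda>.smult_l_distr \<Lambda>.smult_l_minus \<Lambda>.smult_r_minus \<Lambda>.smult_assoc1[symmetric] a_minus_def
    R.m_comm \<Lambda>.M.a_comm)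

end

section \<open>Binary forms\<close>

abbreviation sc :: "'k::field_char_0 \<Rightarrow> 'k poly poly \<Rightarrow> 'k poly poly" where
  "sc c p \<equiv> const c * p"

lemma coeff_const_mult: "coeff (coeff (const c * p) j) i = c * coeff (coeff p j) i"
  by (simp add: const_def)

lemma const_simps [simp]:
  "const 0 = 0" "const 1 = 1" "const (a + b) = const a + const b" "const (a * b) = const a * const b"
  by (simp_all add: const_def one_pCons)

lemma const_eq_0_iff [simp]: "const c = 0 \<longleftrightarrow> c = 0"
  by (simp add: const_def)

lemma vector_space_sc: "vector_space sc"
  by unfold_locales (simp_all add: algebra_simps)

lemma poly_poly_eqI:
  "(\<And>i j. coeff (coeff p j) i = coeff (coeff q j) i) \<Longrightarrow> p = q"
  by (intro poly_eqI) auto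

lemma zero_forms [simp]: "0 \<in> forms d"
  by (simp add: forms_def)

lemma forms_add: "p \<in> forms d \<Longrightarrow> q \<in> forms d \<Longrightarrow> p + q \<in> forms d"
  unfolding forms_def by (auto simp del: of_nat_add) (metis add_0)

lemma forms_uminus: "p \<in> forms d \<Longrightarrow> - p \<in> forms d"
  by (simp add: forms_def)

lemma forms_diff: "p \<in> forms d \<Longrightarrow> q \<in> forms d \<Longrightarrow> p - q \<in> forms d"
  using forms_add[OF _ forms_uminus, of p d q] by simp

lemma forms_const_mult: "p \<in> forms d \<Longrightarrow> const c * p \<in> forms d"
  by (auto simp: forms_def coeff_const_mult)

lemma forms_sum: "(\<And>x. x \<in> A \<Longrightarrow> f x \<in> forms d) \<Longrightarrow> sum f A \<in> forms d"
  by (induction A rule: infinite_finite_induct) (auto simp: forms_add)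

lemma const_forms: "const c \<in> forms 0"
  by (auto simp: forms_def const_def coeff_pCons split: nat.splits if_splits)

lemma X0_forms: "X0 \<in> forms 1"
  by (auto simp: forms_def X0_def coeff_pCons split: nat.splits if_splits)

lemma X1_forms: "X1 \<in> forms 1"
  by (auto simp: forms_def X1_def coeff_pCons split: nat.splits if_splits)

lemma subspace_forms: "module.subspace sc (forms d)"
proof -
  interpret vector_space sc by (rule vector_space_sc)
  show ?thesis by (auto simp: subspace_def forms_add forms_const_mult)
qed

lemma coeff_coeff_mult:
  "coeff (coeff (p * q) j) i =
    (\<Sum>k\<le>j. \<Sum>l\<le>i. coeff (coeff p k) l * coeff (coeff q (j - k)) (i - l))"
  by (simp add: coeff_mult coeff_sum)

text \<open>The homogeneous component of degree \<open>d\<close>. The inner test matters only for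
  negative \<open>d\<close>, where the sum still runs over j = 0.\<close>

definition hcomp :: "int \<Rightarrow> 'k::field_char_0 poly poly \<Rightarrow> 'k poly poly" where
  "hcomp d p = (\<Sum>j\<le>nat d. monom (if int j \<le> d then monom (coeff (coeff p j) (nat (d - int j))) (nat (d - int j)) else 0) j)"

lemma coeff_hcomp: "coeff (coeff (hcomp d p) j) i = (if int i + int j = d then coeff (coeff p j) i else 0)"
proof -
  have "coeff (coeff (hcomp d p) j) i =
      (if j \<le> nat d then coeff (if int j \<le> d then monom (coeff (coeff p j) (nat (d - int j))) (nat (d - int j)) else 0) i else 0)"
    unfolding hcomp_def by (simp add: coeff_sum if_distrib[of "\<lambda>p. coeff p i"] cong: if_cong)
  also have "\<dots> = (if int i + int j = d then coeff (coeff p j) i else 0)" by auto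
  finally show ?thesis .
qed

lemma hcomp_forms: "hcomp d p \<in> forms d"
  by (simp add: forms_def coeff_hcomp)

lemma hcomp_eq: "p \<in> forms d \<Longrightarrow> hcomp d p = p"
  by (intro poly_poly_eqI) (auto simp: coeff_hcomp forms_def)

lemma hcomp_add: "hcomp d (p + q) = hcomp d p + hcomp d q"
  by (intro poly_poly_eqI) (simp add: coeff_hcomp)

lemma hcomp_mult:
  assumes "p \<in> forms e"
  shows "hcomp d (p * q) = p * hcomp (d - e) q"
proof (rule poly_poly_eqI)
  fix i j
  \<comment> \<open>A nonzero coefficient of \<open>p\<close> has l + k = e, so the degree condition
    on the cofactor becomes i + j = d, which no longer depends on the summation indices.\<close>
  have "coeff (coeff p k) l * coeff (coeff (hcomp (d - e) q) (j - k)) (i - l) =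
      (if int i + int j = d then coeff (coeff p k) l * coeff (coeff q (j - k)) (i - l) else 0)"
    if "k \<le> j" "l \<le> i" for k l
  proof (cases "coeff (coeff p k) l = 0")
    case False
    then have "int l + int k = e" using assms by (auto simp: forms_def)
    then show ?thesis using that by (auto simp: coeff_hcomp)
  qed simp
  then have "coeff (coeff (p * hcomp (d - e) q) j) i =
      (\<Sum>k\<le>j. \<Sum>l\<le>i. if int i + int j = d then coeff (coeff p k) l * coeff (coeff q (j - k)) (i - l) else 0)"
    unfolding coeff_coeff_mult by (intro sum.cong refl) auto
  also have "\<dots> = coeff (coeff (hcomp d (p * q)) j) i"
    by (simp add: coeff_hcomp coeff_coeff_mult)
  finally show "coeff (coeff (hcomp d (p * q)) j) i = coeff (coeff (p * hcomp (d - e) q) j) i" ..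
qed

lemma forms_mult:
  assumes "p \<in> forms d" "q \<in> forms e"
  shows "p * q \<in> forms (d + e)"
  using hcomp_mult[OF assms(1), of "d + e" q] hcomp_eq[OF assms(2)] hcomp_forms[of "d + e" "p * q"]
  by simp

text \<open>Taking the component of degree \<open>e\<close> of the product replaces \<open>q\<close>
  by its component of degree e - d; cancelling \<open>p\<close> shows that the two are equal. This
  is how the cofactors of syzygies are seen to be homogeneous.\<close>

lemma forms_mult_cancel:
  assumes "p \<in> forms d" "p \<noteq> 0" "p * q \<in> forms e"
  shows "q \<in> forms (e - d)"
proof -
  have "p * q = p * hcomp (e - d) q"
    using hcomp_mult[OF assms(1), of e q] hcomp_eq[OF assms(3)] by simp
  then have "q = hcomp (e - d) q" using assms(2) by simp
  then show ?thesis using hcomp_forms by metis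
qed

lemma forms_power: "p \<in> forms d \<Longrightarrow> p ^ n \<in> forms (int n * d)"
proof (induction n)
  case 0
  then show ?case using const_forms[of 1] by simp
next
  case (Suc n)
  then show ?case using forms_mult[of p d "p ^ n" "int n * d"] by (simp add: algebra_simps)
qed

lemma forms_prod: "(\<And>x. x \<in> A \<Longrightarrow> f x \<in> forms (d x)) \<Longrightarrow> prod f A \<in> forms (sum d A)"
  using const_forms[of 1]
  by (induction A rule: infinite_finite_induct) (auto simp: forms_mult)

lemma coord_space_forms:
  "coord_space (vsp sc (forms d :: 'k::field_char_0 poly poly set)) (nat (d + 1))"
proof -
  define n where "n = nat (d + 1)"
  \<comment> \<open>Entry j becomes the coefficient of X0^(n-1-j) X1^j. For d \<ge> 0 the first
    exponent is d - j; for negative \<open>d\<close> there are no entries and no nonzero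
    forms.\<close>
  define T :: "'k vec \<Rightarrow> 'k poly poly" where "T = (\<lambda>v. \<Sum>j<n. monom (monom (v $ j) (n - 1 - j)) j)"
  have cT: "coeff (coeff (T v) j) i = (if j < n \<and> i = n - 1 - j then v $ j else 0)" for v i j
    unfolding T_def by (simp add: coeff_sum if_distrib[of "\<lambda>p. coeff p i"] cong: if_cong)
  have vs: "vectorspace base_field (vsp sc (forms d :: 'k poly poly set))"
    by (rule vectorspace_vsp[OF vector_space_sc subspace_forms])
  have T_forms: "T v \<in> forms d" for v
    by (auto simp: forms_def cT n_def split: if_splits)
  have lin: "linear_map base_field (module_vec TYPE('k) n) (vsp sc (forms d)) T"
    by (intro linear_mapI vs)
      (auto simp: module_vec_simps ring_of_type_algebra_def vec_vs T_forms cT coeff_const_mult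
        intro!: poly_poly_eqI)
  have "bij_betw T (carrier_vec n) (forms d)"
  proof (rule bij_betwI[where g = "\<lambda>p. vec n (\<lambda>j. coeff (coeff p j) (n - 1 - j))"])
    show "T (vec n (\<lambda>j. coeff (coeff p j) (n - 1 - j))) = p" if "p \<in> forms d" for p
      using that by (intro poly_poly_eqI) (fastforce simp: cT forms_def n_def)
  qed (auto simp: T_forms cT)
  then have bij: "bij_betw T (carrier_vec n) (carrier (vsp sc (forms d)))" by simp
  show ?thesis
    unfolding coord_space_def n_def[symmetric]
    by (rule conjI, rule vs, rule exI[of _ T], rule conjI, rule lin, rule bij)
qed

section \<open>Partial derivatives\<close>

definition D0 :: "'k::field_char_0 poly poly \<Rightarrow> 'k poly poly" where
  "D0 = map_poly pderiv"

definition D1 :: "'k::field_char_0 poly poly \<Rightarrow> 'k poly poly" where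
  "D1 = pderiv"

lemma coeff_D0: "coeff (D0 p) j = pderiv (coeff p j)"
  by (simp add: D0_def coeff_map_poly)

lemma D0_add: "D0 (p + q) = D0 p + D0 q"
  by (intro poly_eqI) (simp add: coeff_D0 pderiv_add)

lemma D1_add: "D1 (p + q) = D1 p + D1 q"
  by (simp add: D1_def pderiv_add)

text \<open>\<open>X0\<close> lives in the coefficients, so \<open>D0\<close> differentiates
  coefficientwise and the Leibniz rule has to be drawn from the convolution formula for each
  coefficient.\<close>

lemma D0_mult: "D0 (p * q) = p * D0 q + q * D0 p"
proof (rule poly_eqI)
  fix n
  have "coeff (D0 (p * q)) n = (\<Sum>i\<le>n. pderiv (coeff p i * coeff q (n - i)))"
    by (simp add: coeff_D0 coeff_mult higher_pderiv_sum[where n=1, simplified])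
  also have "\<dots> = coeff (p * D0 q) n + coeff (D0 p * q) n"
    unfolding coeff_mult coeff_D0 sum.distrib[symmetric] by (simp add: pderiv_mult mult.commute)
  finally show "coeff (D0 (p * q)) n = coeff (p * D0 q + q * D0 p) n"
    unfolding mult.commute[of q "D0 p"] coeff_add .
qed

lemma D1_mult: "D1 (p * q) = p * D1 q + q * D1 p"
  by (simp add: D1_def pderiv_mult)

lemma D_simps [simp]:
  "D0 (const c) = 0" "D1 (const c) = 0" "D0 X0 = 1" "D1 X0 = 0" "D0 X1 = 0" "D1 X1 = 1" "D0 0 = 0" "D1 0 = 0"
  by (simp_all add: D0_def D1_def const_def X0_def X1_def map_poly_pCons pderiv_pCons one_pCons)

lemma D0_diff: "D0 (p - q) = D0 p - D0 q"
  using D0_add[of "p - q" q] by simp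

lemma D1_diff: "D1 (p - q) = D1 p - D1 q"
  using D1_add[of "p - q" q] by simp

lemma coeff_coeff_D1: "coeff (coeff (D1 p) j) i = of_nat (Suc j) * coeff (coeff p (Suc j)) i"
  by (simp add: D1_def coeff_pderiv of_nat_poly del: of_nat_Suc)

lemma coeff_coeff_D0: "coeff (coeff (D0 p) j) i = of_nat (Suc i) * coeff (coeff p j) (Suc i)"
  by (simp add: coeff_D0 coeff_pderiv del: of_nat_Suc)

lemma D0_forms:
  assumes "p \<in> forms d"
  shows "D0 p \<in> forms (d - 1)"
  unfolding forms_def
proof (rule CollectI, intro allI impI)
  fix i j assume "coeff (coeff (D0 p) j) i \<noteq> 0"
  then have "coeff (coeff p j) (Suc i) \<noteq> 0" by (auto simp: coeff_coeff_D0)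
  then have "int (Suc i) + int j = d" using assms unfolding forms_def by blast
  then show "int i + int j = d - 1" by simp
qed

lemma D1_forms:
  assumes "p \<in> forms d"
  shows "D1 p \<in> forms (d - 1)"
  unfolding forms_def
proof (rule CollectI, intro allI impI)
  fix i j assume "coeff (coeff (D1 p) j) i \<noteq> 0"
  then have "coeff (coeff p (Suc j)) i \<noteq> 0" by (auto simp: coeff_coeff_D1)
  then have "int i + int (Suc j) = d" using assms unfolding forms_def by blast
  then show "int i + int j = d - 1" by simp
qed

lemma coeff_X0_mult: "coeff (coeff (X0 * q) j) i = (if i = 0 then 0 else coeff (coeff q j) (i - 1))"
  by (auto simp: X0_def coeff_pCons split: nat.splits)

lemma coeff_X1_mult: "coeff (coeff (X1 * q) j) i = (if j = 0 then 0 else coeff (coeff q (j - 1)) i)"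
  by (auto simp: X1_def coeff_pCons split: nat.splits)

text \<open>The left side multiplies the coefficient of X0^i X1^j by i + j, which is
  \<open>d\<close> wherever that coefficient is nonzero.\<close>

lemma euler:
  assumes "p \<in> forms d"
  shows "X0 * D0 p + X1 * D1 p = const (of_int d) * p"
proof (rule poly_poly_eqI)
  fix i j
  have "coeff (coeff p j) i = 0 \<or> (of_int d :: 'a) = of_nat i + of_nat j"
  proof (cases "coeff (coeff p j) i = 0")
    case False
    then have "d = int i + int j" using assms by (auto simp: forms_def)
    then show ?thesis by simp
  qed simp
  then show "coeff (coeff (X0 * D0 p + X1 * D1 p) j) i = coeff (coeff (const (of_int d) * p) j) i"
    by (cases i; cases j)
      (auto simp: coeff_X0_mult coeff_X1_mult coeff_coeff_D0 coeff_coeff_D1 coeff_const_mult distrib_right)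
qed

text \<open>The logarithmic derivative, the sum of m i D(l i) / l i, with denominators cleared. The
  factor in front does not involve \<open>D\<close>, so both partial derivatives of \<open>F\<close>
  share it.\<close>

lemma derivation_prod_power:
  fixes D :: "'a::comm_ring_1 \<Rightarrow> 'a" and l :: "'i \<Rightarrow> 'a"
  assumes mult: "\<And>p q. D (p * q) = p * D q + q * D p"
    and "finite S" and "\<And>i. i \<in> S \<Longrightarrow> m i \<ge> 1"
  shows "D (\<Prod>i\<in>S. l i ^ m i) =
    (\<Prod>i\<in>S. l i ^ (m i - 1)) * (\<Sum>i\<in>S. of_nat (m i) * D (l i) * (\<Prod>j\<in>S - {i}. l j))"
  using assms(2,3)
proof (induction S rule: finite_induct)
  case empty
  \<comment> \<open>The Leibniz rule for 1 = 1 * 1 reads D 1 = D 1 + D 1, so D 1 = 0.\<close>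
  show ?case using mult[of 1 1] by simp
next
  case (insert x S)
  have D_power: "D (p ^ Suc n) = of_nat (Suc n) * p ^ n * D p" for p n
    by (induction n) (simp_all add: mult algebra_simps)
  obtain n where n: "m x = Suc n" using insert.prems[of x] by (cases "m x") auto
  have "(\<Sum>i\<in>S. of_nat (m i) * D (l i) * (\<Prod>j\<in>insert x S - {i}. l j)) =
      (\<Sum>i\<in>S. l x * (of_nat (m i) * D (l i) * (\<Prod>j\<in>S - {i}. l j)))"
  proof (rule sum.cong)
    fix i assume "i \<in> S"
    then have "insert x S - {i} = insert x (S - {i})" using insert.hyps by auto
    then show "of_nat (m i) * D (l i) * (\<Prod>j\<in>insert x S - {i}. l j) =
        l x * (of_nat (m i) * D (l i) * (\<Prod>j\<in>S - {i}. l j))"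
      using insert.hyps by (simp add: algebra_simps)
  qed simp
  then have 1: "(\<Sum>i\<in>insert x S. of_nat (m i) * D (l i) * (\<Prod>j\<in>insert x S - {i}. l j)) =
      of_nat (Suc n) * D (l x) * prod l S + l x * (\<Sum>i\<in>S. of_nat (m i) * D (l i) * (\<Prod>j\<in>S - {i}. l j))"
    using insert.hyps n by (simp add: sum_distrib_left)
  have 2: "(\<Prod>i\<in>S. l i ^ m i) = (\<Prod>i\<in>S. l i ^ (m i - 1)) * prod l S"
    unfolding prod.distrib[symmetric]
  proof (rule prod.cong)
    fix i assume "i \<in> S"
    then have "m i > 0" using insert.prems[of i] by simp
    then show "l i ^ m i = l i ^ (m i - 1) * l i" using power_minus_mult[of "m i" "l i"] by simp
  qed simp
  have 3: "D (\<Prod>i\<in>S. l i ^ m i) =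
      (\<Prod>i\<in>S. l i ^ (m i - 1)) * (\<Sum>i\<in>S. of_nat (m i) * D (l i) * (\<Prod>j\<in>S - {i}. l j))"
    using insert by auto
  have "D (\<Prod>i\<in>insert x S. l i ^ m i) =
      l x ^ Suc n * D (\<Prod>i\<in>S. l i ^ m i) + (\<Prod>i\<in>S. l i ^ m i) * (of_nat (Suc n) * l x ^ n * D (l x))"
    using insert.hyps n mult[of "l x ^ Suc n"] unfolding D_power by simp
  also have "\<dots> = (l x ^ n * (\<Prod>i\<in>S. l i ^ (m i - 1))) * (of_nat (Suc n) * D (l x) * prod l S +
      l x * (\<Sum>i\<in>S. of_nat (m i) * D (l i) * (\<Prod>j\<in>S - {i}. l j)))"
    unfolding 3 unfolding 2 by (simp add: algebra_simps)
  finally show ?case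
    unfolding 1 using insert.hyps n by simp
qed

text \<open>Roots are split off one at a time: without zero divisors, a root other than
  \<open>c x\<close> passes from \<open>g\<close> to its cofactor. The application has coefficients
  in K[X0] and the roots a i X0.\<close>

lemma prod_linear_dvd:
  fixes c :: "'i \<Rightarrow> 'a::idom"
  assumes "finite S" "inj_on c S" "\<And>i. i \<in> S \<Longrightarrow> poly g (c i) = 0"
  shows "(\<Prod>i\<in>S. [:- c i, 1:]) dvd g"
  using assms
proof (induction S arbitrary: g rule: finite_induct)
  case (insert x S)
  obtain h where h: "g = [:- c x, 1:] * h"
    using insert.prems(2)[of x] unfolding poly_eq_0_iff_dvd dvd_def by auto
  have "poly h (c i) = 0" if "i \<in> S" for i
  proof -
    have "poly g (c i) = 0" using insert.prems that by simp
    moreover have "c i \<noteq> c x" using insert.prems(1) insert.hyps that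
      by (metis inj_on_contraD insertCI)
    ultimately show ?thesis by (simp add: h)
  qed
  then have "(\<Prod>i\<in>S. [:- c i, 1:]) dvd h" using insert by simp
  then show ?case using insert.hyps h by (simp del: mult_pCons_left)
qed simp

section \<open>Syzygies of a product of linear forms\<close>

lemma of_nat_eq_const: "of_nat n = const (of_nat n)"
  by (induction n) simp_all

locale split_form =
  fixes s :: nat and m :: "nat \<Rightarrow> nat" and a :: "nat \<Rightarrow> 'k::field_char_0"
  assumes s_ge: "s \<ge> 1"
    and m_ge: "\<And>i. i \<in> {1..s} \<Longrightarrow> m i \<ge> 1"
    and inj_a: "inj_on a {1..s}"
begin

definition l where "l i = X1 - const (a i) * X0"
definition F where "F = (\<Prod>i=1..s. l i ^ m i)"
definition G where "G = (\<Prod>i=1..s. l i ^ (m i - 1))"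
definition P where "P = (\<Prod>i=1..s. l i)"
text \<open>\<open>A\<close> and \<open>B\<close> are the second factors delivered by
  \<open>derivation_prod_power\<close>. As \<open>D1 (l i)\<close> is 1 and \<open>D0 (l i)\<close>
  is - a i, \<open>B\<close> sums m i times the product of the other linear forms, and
  \<open>A\<close> carries the additional weights - a i.\<close>

definition A where "A = (\<Sum>i=1..s. of_nat (m i) * D0 (l i) * (\<Prod>j\<in>{1..s} - {i}. l j))"
definition B where "B = (\<Sum>i=1..s. of_nat (m i) * D1 (l i) * (\<Prod>j\<in>{1..s} - {i}. l j))"
definition \<mu> where "\<mu> = int (\<Sum>i=1..s. m i)"

lemma l_eq: "l i = [:- [:0, a i:], 1:]"
  by (simp add: l_def X1_def X0_def const_def)

lemma l_forms: "l i \<in> forms 1"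
  unfolding l_def by (intro forms_diff X1_forms forms_const_mult X0_forms)

lemma l_nz: "l i \<noteq> 0"
  by (simp add: l_eq)

lemma G_nz: "G \<noteq> 0" and P_nz: "P \<noteq> 0"
  by (simp_all add: G_def P_def l_nz)

lemma F_eq: "F = G * P"
  unfolding F_def G_def P_def prod.distrib[symmetric]
proof (rule prod.cong)
  fix i assume "i \<in> {1..s}"
  then show "l i ^ m i = l i ^ (m i - 1) * l i"
    using power_minus_mult[of "m i" "l i"] m_ge[of i] by simp
qed simp

lemma D0_F: "D0 F = G * A"
  unfolding F_def G_def A_def
  by (rule derivation_prod_power) (rule D0_mult, simp, rule m_ge)

lemma D1_F: "D1 F = G * B"
  unfolding F_def G_def B_def
  by (rule derivation_prod_power) (rule D1_mult, simp, rule m_ge)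

lemma F_forms: "F \<in> forms \<mu>"
proof -
  have "F \<in> forms (\<Sum>i=1..s. int (m i) * 1)"
    unfolding F_def by (intro forms_prod forms_power l_forms)
  then show ?thesis by (simp add: \<mu>_def)
qed

lemma P_forms: "P \<in> forms (int s)"
proof -
  have "P \<in> forms (\<Sum>i=1..s. 1)"
    unfolding P_def by (intro forms_prod l_forms)
  then show ?thesis by simp
qed

lemma summand_forms:
  assumes "i \<in> {1..s}" "D (l i) \<in> forms 0"
  shows "of_nat (m i) * D (l i) * (\<Prod>j\<in>{1..s} - {i}. l j) \<in> forms (int s - 1)"
proof -
  have "(\<Prod>j\<in>{1..s} - {i}. l j) \<in> forms (\<Sum>j\<in>{1..s} - {i}. 1)"
    by (intro forms_prod l_forms)
  also have "(\<Sum>j\<in>{1..s} - {i}. 1) = int s - 1"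
    using assms(1) s_ge by (simp add: of_nat_diff)
  finally show ?thesis
    using forms_mult[OF forms_const_mult[OF assms(2)]] unfolding of_nat_eq_const by fastforce
qed

lemma A_forms: "A \<in> forms (int s - 1)"
  unfolding A_def
  by (intro forms_sum summand_forms) (use D0_forms[OF l_forms] in simp_all)

lemma B_forms: "B \<in> forms (int s - 1)"
  unfolding B_def
  by (intro forms_sum summand_forms) (use D1_forms[OF l_forms] in simp_all)

lemma euler_F: "X0 * D0 F + X1 * D1 F = const (of_int \<mu>) * F"
  by (rule euler[OF F_forms])

text \<open>Euler's formula for \<open>F\<close> with \<open>G\<close> cancelled. The constant stays
  \<mu>, the degree of \<open>F\<close>, because \<open>A\<close> and \<open>B\<close> carry the
  multiplicities.\<close>

lemma euler_P: "X0 * A + X1 * B = const (of_int \<mu>) * P"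
proof -
  have "X0 * (G * A) + X1 * (G * B) = const (of_int \<mu>) * F"
    using euler_F unfolding D0_F D1_F .
  then have "G * (X0 * A + X1 * B) = G * (const (of_int \<mu>) * P)"
    unfolding F_eq by (simp add: algebra_simps)
  then show ?thesis using G_nz by simp
qed

lemma \<mu>_ge: "\<mu> \<ge> int s"
proof -
  have "(\<Sum>i=1..s. 1) \<le> (\<Sum>i=1..s. m i)" by (intro sum_mono m_ge)
  then show ?thesis unfolding \<mu>_def by (simp del: of_nat_sum)
qed

lemma \<mu>_nz: "(of_int \<mu> :: 'k) \<noteq> 0"
  using \<mu>_ge s_ge by simp

lemma F_in_J: "F = const (inverse (of_int \<mu>)) * X0 * D0 F + const (inverse (of_int \<mu>)) * X1 * D1 F"
proof -
  have "const (inverse (of_int \<mu>)) * (X0 * D0 F + X1 * D1 F) = const (inverse (of_int \<mu>) * of_int \<mu>) * F"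
    unfolding euler_F by simp
  then show ?thesis using \<mu>_nz by (simp add: algebra_simps del: const_simps(4))
qed

text \<open>Substituting a i X0 for X1 kills \<open>l i\<close>, a factor of every summand but the
  i-th. What remains is m i times the product of the (a i - a j) X0, nonzero because the
  characteristic is zero and the a j are distinct.\<close>

lemma poly_B: 
  assumes i: "i \<in> {1..s}"
  shows "poly B [:0, a i:] \<noteq> 0"
proof -
  have "poly B [:0, a i:] = (\<Sum>k=1..s. of_nat (m k) * (\<Prod>j\<in>{1..s} - {k}. [:0, a i:] - [:0, a j:]))"
    by (simp add: B_def poly_sum poly_prod l_eq D1_def pderiv_pCons)
  also have "\<dots> = (\<Sum>k=1..s. if k = i then of_nat (m i) * (\<Prod>j\<in>{1..s} - {i}. [:0, a i:] - [:0, a j:]) else 0)"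
  proof (intro sum.cong refl)
    fix k assume "k \<in> {1..s}"
    then have "(\<Prod>j\<in>{1..s} - {k}. [:0, a i:] - [:0, a j:]) = 0" if "k \<noteq> i"
      using that i by (intro prod_zero) auto
    then show "of_nat (m k) * (\<Prod>j\<in>{1..s} - {k}. [:0, a i:] - [:0, a j:]) =
        (if k = i then of_nat (m i) * (\<Prod>j\<in>{1..s} - {i}. [:0, a i:] - [:0, a j:]) else 0)" by simp
  qed
  also have "\<dots> = of_nat (m i) * (\<Prod>j\<in>{1..s} - {i}. [:0, a i:] - [:0, a j:])"
    using i by simp
  finally have "poly B [:0, a i:] = of_nat (m i) * (\<Prod>j\<in>{1..s} - {i}. [:0, a i:] - [:0, a j:])" .
  moreover have "of_nat (m i) \<noteq> (0 :: 'k poly)"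
    using m_ge[OF i] by simp
  moreover have "[:0, a i:] - [:0, a j:] \<noteq> 0" if "j \<in> {1..s} - {i}" for j
    using inj_onD[OF inj_a, of i j] that i by auto
  then have "(\<Prod>j\<in>{1..s} - {i}. [:0, a i:] - [:0, a j:]) \<noteq> 0"
    by simp
  ultimately show ?thesis by simp
qed

lemma B_nz: "B \<noteq> 0"
  using poly_B[of 1] s_ge by auto

text \<open>Divisibility by \<open>P\<close> is tested at its distinct roots in K[X0]: each is a
  root of \<open>g * B\<close> but, by \<open>poly_B\<close>, not of \<open>B\<close>, hence it is a
  root of \<open>g\<close>.\<close>

lemma P_dvd_cancel:
  assumes "P dvd g * B"
  shows "P dvd g"
proof -
  have root: "poly g [:0, a i:] = 0" if i: "i \<in> {1..s}" for i
  proof -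
    have "l i dvd g * B" using i assms unfolding P_def by (meson dvd_prodI dvd_trans finite_atLeastAtMost)
    then have "poly (g * B) [:0, a i:] = 0" unfolding l_eq poly_eq_0_iff_dvd .
    then show ?thesis using poly_B[OF i] by simp
  qed
  have inj: "inj_on (\<lambda>i. [:0, a i:]) {1..s}"
    by (rule inj_onI, rule inj_onD[OF inj_a]) simp_all
  have "(\<Prod>i\<in>{1..s}. [:- [:0, a i:], 1:]) dvd g"
    by (rule prod_linear_dvd[OF finite_atLeastAtMost inj root])
  then show ?thesis by (simp only: P_def l_eq)
qed

text \<open>Without \<open>G\<close> a syzygy reads u A + v B = 0. Euler's formula for
  \<open>P\<close> eliminates \<open>A\<close> and gives \<mu> u P = (X1 u - X0 v) B, so
  \<open>P\<close> divides X1 u - X0 v. The cofactor is the wanted \<open>k\<close> up to the unit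
  \<mu>.\<close>

lemma syzygy2:
  assumes "u \<in> forms e" "v \<in> forms e"
  shows "u * D0 F + v * D1 F = 0 \<longleftrightarrow> (\<exists>k\<in>forms (e + 1 - int s). u = B * k \<and> v = - (A * k))"
proof
  assume "u * D0 F + v * D1 F = 0"
  then have "G * (u * A + v * B) = 0" unfolding D0_F D1_F by (simp add: algebra_simps)
  then have uv: "u * A + v * B = 0" using G_nz by simp
  define M where "M = const (of_int \<mu> :: 'k)"
  have M_nz: "M \<noteq> 0" using \<mu>_nz by (simp add: M_def)
  have "M * u * P = u * (X0 * A + X1 * B) - X0 * (u * A + v * B)"
    unfolding euler_P uv M_def by simp
  also have "\<dots> = (X1 * u - X0 * v) * B" by (simp add: algebra_simps)
  finally have eq: "M * u * P = (X1 * u - X0 * v) * B" .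
  have "P dvd (X1 * u - X0 * v) * B" unfolding eq[symmetric] by simp
  then have "P dvd X1 * u - X0 * v" by (rule P_dvd_cancel)
  then obtain k where k: "X1 * u - X0 * v = P * k" by (elim dvdE)
  have "P * (M * u) = P * (B * k)" using eq unfolding k by (simp add: algebra_simps)
  then have u: "M * u = B * k" using P_nz by simp
  \<comment> \<open>The second component follows from the first through the syzygy itself, after
    cancelling \<open>B\<close>.\<close>
  have "B * (M * v) = M * (u * A + v * B) - A * (M * u)" by (simp add: algebra_simps)
  also have "\<dots> = B * (- (A * k))" unfolding uv u by simp
  finally have v: "M * v = - (A * k)" unfolding mult_left_cancel[OF B_nz] .
  \<comment> \<open>Removes the factor \<mu> that Euler's formula introduced.\<close>
  define k' where "k' = const (inverse (of_int \<mu>)) * k"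
  have "const (inverse (of_int \<mu>)) * M = const (inverse (of_int \<mu>) * of_int \<mu>)"
    unfolding M_def by simp
  then have inv: "const (inverse (of_int \<mu>)) * M = 1" using \<mu>_nz by (simp del: const_simps(4))
  have "u = const (inverse (of_int \<mu>)) * M * u" unfolding inv by simp
  also have "\<dots> = const (inverse (of_int \<mu>)) * (M * u)" by (simp only: mult.assoc)
  also have "\<dots> = B * k'" unfolding u k'_def by simp
  finally have u': "u = B * k'" .
  have "v = const (inverse (of_int \<mu>)) * M * v" unfolding inv by simp
  also have "\<dots> = const (inverse (of_int \<mu>)) * (M * v)" by (simp only: mult.assoc)
  also have "\<dots> = - (A * k')" unfolding v k'_def by simp
  finally have v': "v = - (A * k')" .
  \<comment> \<open>\<open>B\<close> is a nonzero form of degree s - 1, so u = B k' fixes the degree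
    of the cofactor.\<close>
  have "k' \<in> forms (e - (int s - 1))"
    using forms_mult_cancel[OF B_forms B_nz, of k' e] assms(1) u' by simp
  then show "\<exists>k\<in>forms (e + 1 - int s). u = B * k \<and> v = - (A * k)"
    using u' v' by (intro bexI[of _ k']) (simp_all add: algebra_simps)
next
  assume "\<exists>k\<in>forms (e + 1 - int s). u = B * k \<and> v = - (A * k)"
  then show "u * D0 F + v * D1 F = 0" unfolding D0_F D1_F by (auto simp: algebra_simps)
qed

text \<open>Without \<open>G\<close> the equations read P u + g A = 0 and P v + g B = 0. The second
  makes \<open>P\<close> divide g B and hence \<open>g\<close>; cancelling \<open>P\<close> then
  determines \<open>u\<close> and \<open>v\<close>. The generator, k = 1, expresses the identity P
  dF = A F dx0 + B F dx1.\<close>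

lemma syzygy3:
  assumes "g \<in> forms e"
  shows "F * u + g * D0 F = 0 \<and> F * v + g * D1 F = 0 \<longleftrightarrow>
    (\<exists>k\<in>forms (e - int s). g = P * k \<and> u = - (A * k) \<and> v = - (B * k))"
proof
  assume "F * u + g * D0 F = 0 \<and> F * v + g * D1 F = 0"
  then have "G * (P * u + g * A) = 0" "G * (P * v + g * B) = 0"
    unfolding D0_F D1_F unfolding F_eq by (simp_all add: algebra_simps)
  then have u: "P * u + g * A = 0" and v: "P * v + g * B = 0" using G_nz by simp_all
  have "g * B = P * (- v)" using v by (simp add: eq_neg_iff_add_eq_0 add.commute)
  then have "P dvd g * B" by simp
  then have "P dvd g" by (rule P_dvd_cancel)
  then obtain k where k: "g = P * k" by (elim dvdE)
  have "P * (u + A * k) = 0" "P * (v + B * k) = 0" using u v unfolding k by (simp_all add: algebra_simps)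
  then have "u = - (A * k)" "v = - (B * k)" using P_nz by (simp_all add: eq_neg_iff_add_eq_0)
  moreover have "k \<in> forms (e - int s)"
    using forms_mult_cancel[OF P_forms P_nz, of k e] assms k by simp
  ultimately show "\<exists>k\<in>forms (e - int s). g = P * k \<and> u = - (A * k) \<and> v = - (B * k)"
    using k by blast
next
  assume "\<exists>k\<in>forms (e - int s). g = P * k \<and> u = - (A * k) \<and> v = - (B * k)"
  then show "F * u + g * D0 F = 0 \<and> F * v + g * D1 F = 0"
    unfolding D0_F D1_F unfolding F_eq by (auto simp: algebra_simps)
qed

text \<open>\<open>J e\<close> and \<open>N e\<close> are the graded pieces, with coefficients of degrees \<open>e + \<mu> - 1\<close> and \<open>e + \<mu>\<close>, of the submodules of
  relations of \<open>\<Omega>\<^sup>2\<close> and \<open>\<Omega>\<^sup>1\<close>; these are called \<open>jac\<close> and \<open>rels\<close> below.\<close>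

definition J where "J e = (\<lambda>(u, v). u * D0 F + v * D1 F) ` (forms e \<times> forms e)"

definition N where
  "N e = (\<lambda>(g, u, v). (F * u + g * D0 F, F * v + g * D1 F)) ` (forms (e + 1) \<times> forms e \<times> forms e)"

abbreviation sc2 :: "'k \<Rightarrow> 'k poly poly \<times> 'k poly poly \<Rightarrow> 'k poly poly \<times> 'k poly poly" where
  "sc2 \<equiv> prod_scale sc sc"

abbreviation sc3 :: "'k \<Rightarrow> 'k poly poly \<times> 'k poly poly \<times> 'k poly poly
    \<Rightarrow> 'k poly poly \<times> 'k poly poly \<times> 'k poly poly" where
  "sc3 \<equiv> prod_scale sc sc2"

lemma vector_space_sc2: "vector_space sc2"
  by (intro vector_space_prod_scale vector_space_sc)

lemma vector_space_sc3: "vector_space sc3"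
  by (intro vector_space_prod_scale vector_space_sc)

lemma subspace_forms2: "module.subspace sc2 (forms d \<times> forms e)"
  by (intro subspace_prod_scale vector_space_sc subspace_forms)

lemma subspace_forms3: "module.subspace sc3 (forms d \<times> forms e \<times> forms f)"
  by (intro subspace_prod_scale vector_space_sc vector_space_sc2 subspace_forms subspace_forms2)

lemma coord_space_forms2:
  "coord_space (vsp sc2 (forms d \<times> forms e)) (nat (d + 1) + nat (e + 1))"
  by (intro coord_space_prod vector_space_sc subspace_forms coord_space_forms)

lemma coord_space_forms3:
  "coord_space (vsp sc3 (forms d \<times> forms e \<times> forms f)) (nat (d + 1) + (nat (e + 1) + nat (f + 1)))"
  by (intro coord_space_prod vector_space_sc vector_space_sc2 subspace_forms subspace_forms2
      coord_space_forms coord_space_forms2)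

lemma vectorspace_forms: "vectorspace base_field (vsp sc (forms d :: 'k poly poly set))"
  by (rule vectorspace_vsp[OF vector_space_sc subspace_forms])

lemma vectorspace_forms2: "vectorspace base_field (vsp sc2 (forms d \<times> forms e))"
  by (rule vectorspace_vsp[OF vector_space_sc2 subspace_forms2])

lemma vectorspace_forms3: "vectorspace base_field (vsp sc3 (forms d \<times> forms e \<times> forms f))"
  by (rule vectorspace_vsp[OF vector_space_sc3 subspace_forms3])

lemma vectorspace_J: "vectorspace base_field (vsp sc (J e))"
proof -
  interpret sc: vector_space sc by (rule vector_space_sc)
  have "sc.subspace (J e)"
  proof (rule sc.subspaceI)
    show "0 \<in> J e" unfolding J_def by (rule image_eqI[of _ _ "(0, 0)"]) auto
  next
    fix x y assume "x \<in> J e" "y \<in> J e"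
    then obtain u v u' v' where "u \<in> forms e" "v \<in> forms e" "u' \<in> forms e" "v' \<in> forms e"
      "x = u * D0 F + v * D1 F" "y = u' * D0 F + v' * D1 F" by (auto simp: J_def)
    then show "x + y \<in> J e" unfolding J_def
      by (intro image_eqI[of _ _ "(u + u', v + v')"]) (auto simp: algebra_simps forms_add)
  next
    fix c x assume "x \<in> J e"
    then obtain u v where "u \<in> forms e" "v \<in> forms e" "x = u * D0 F + v * D1 F" by (auto simp: J_def)
    then show "sc c x \<in> J e" unfolding J_def
      by (intro image_eqI[of _ _ "(sc c u, sc c v)"]) (auto simp: distrib_left mult.assoc mult.left_commute[of F "const c"] forms_const_mult)
  qed
  then show ?thesis by (rule vectorspace_vsp[OF vector_space_sc])
qed

lemma vectorspace_N: "vectorspace base_field (vsp sc2 (N e))"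
proof -
  interpret sc: vector_space sc2 by (rule vector_space_sc2)
  have "sc.subspace (N e)"
  proof (rule sc.subspaceI)
    show "0 \<in> N e" unfolding N_def by (rule image_eqI[of _ _ "(0, 0, 0)"]) (auto simp: zero_prod_def)
  next
    fix x y assume "x \<in> N e" "y \<in> N e"
    then obtain g u v g' u' v' where "g \<in> forms (e + 1)" "g' \<in> forms (e + 1)"
      "u \<in> forms e" "v \<in> forms e" "u' \<in> forms e" "v' \<in> forms e"
      "x = (F * u + g * D0 F, F * v + g * D1 F)" "y = (F * u' + g' * D0 F, F * v' + g' * D1 F)"
      by (auto simp: N_def)
    then show "x + y \<in> N e" unfolding N_def
      by (intro image_eqI[of _ _ "(g + g', u + u', v + v')"]) (auto simp: algebra_simps forms_add)
  next
    fix c x assume "x \<in> N e"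
    then obtain g u v where "g \<in> forms (e + 1)" "u \<in> forms e" "v \<in> forms e"
      "x = (F * u + g * D0 F, F * v + g * D1 F)" by (auto simp: N_def)
    then show "sc2 c x \<in> N e" unfolding N_def
      by (intro image_eqI[of _ _ "(sc c g, sc c u, sc c v)"]) (auto simp: distrib_left mult.assoc mult.left_commute[of F "const c"] forms_const_mult)
  qed
  then show ?thesis by (rule vectorspace_vsp[OF vector_space_sc2])
qed

text \<open>Forms of degree d span dimension nat (d + 1). By \<open>syzygy2\<close> the kernel of
  the map from pairs onto \<open>J e\<close> is a copy of the forms of degree e + 1 - s.\<close>

lemma dim_J:
  shows "vectorspace.fin_dim base_field (vsp sc (J e))"
    and "vectorspace.dim base_field (vsp sc (J e)) + nat (e + 2 - int s) = 2 * nat (e + 1)"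
proof -
  let ?T = "\<lambda>(u, v). u * D0 F + v * D1 F" and ?S = "\<lambda>k. (B * k, - (A * k))"
  have T: "linear_map base_field (vsp sc2 (forms e \<times> forms e)) (vsp sc (J e)) ?T"
    by (intro linear_mapI vectorspace_J vectorspace_forms2) (auto simp: algebra_simps J_def)
  have Bk: "B * k \<in> forms e" "A * k \<in> forms e" if "k \<in> forms (e + 1 - int s)" for k
    using forms_mult[OF B_forms that] forms_mult[OF A_forms that] by simp_all
  have S: "linear_map base_field (vsp sc (forms (e + 1 - int s))) (vsp sc2 (forms e \<times> forms e)) ?S"
    by (intro linear_mapI vectorspace_forms vectorspace_forms2)
      (auto simp: distrib_left mult.left_commute[of _ "const _"] Bk forms_uminus)
  have inj: "inj_on ?S (carrier (vsp sc (forms (e + 1 - int s))))"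
    using B_nz by (auto simp: inj_on_def)
  have ker: "?S ` carrier (vsp sc (forms (e + 1 - int s))) =
      {v \<in> carrier (vsp sc2 (forms e \<times> forms e)). ?T v = \<zero>\<^bsub>vsp sc (J e)\<^esub>}"
  proof (intro equalityI subsetI)
    fix x assume "x \<in> ?S ` carrier (vsp sc (forms (e + 1 - int s)))"
    then obtain k where k: "k \<in> forms (e + 1 - int s)" and x: "x = ?S k" by auto
    have "B * k * D0 F + - (A * k) * D1 F = 0"
      using syzygy2[of "B * k" e "- (A * k)"] Bk[OF k] forms_uminus k by blast
    then show "x \<in> {v \<in> carrier (vsp sc2 (forms e \<times> forms e)). ?T v = \<zero>\<^bsub>vsp sc (J e)\<^esub>}"
      unfolding x using Bk[OF k] forms_uminus[OF Bk(2)[OF k]] by simp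
  next
    fix x assume "x \<in> {v \<in> carrier (vsp sc2 (forms e \<times> forms e)). ?T v = \<zero>\<^bsub>vsp sc (J e)\<^esub>}"
    then obtain u v where x: "x = (u, v)" and uv: "u \<in> forms e" "v \<in> forms e"
      and "u * D0 F + v * D1 F = 0" by auto
    then obtain k where "k \<in> forms (e + 1 - int s)" "u = B * k" "v = - (A * k)"
      using syzygy2[OF uv] by blast
    then show "x \<in> ?S ` carrier (vsp sc (forms (e + 1 - int s)))"
      unfolding x by (intro image_eqI[of _ _ k]) simp_all
  qed
  have surj: "?T ` carrier (vsp sc2 (forms e \<times> forms e)) = carrier (vsp sc (J e))"
    by (simp add: J_def)
  note ex = dim_exact[OF T coord_space_dim(1)[OF coord_space_forms2] surj S
      coord_space_dim(1)[OF coord_space_forms] inj ker]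
  show "vectorspace.fin_dim base_field (vsp sc (J e))" by (rule ex(1))
  show "vectorspace.dim base_field (vsp sc (J e)) + nat (e + 2 - int s) = 2 * nat (e + 1)"
    using ex(2) unfolding coord_space_dim(2)[OF coord_space_forms2] coord_space_dim(2)[OF coord_space_forms]
    by (simp add: algebra_simps)
qed

text \<open>The coefficient of dF has degree e + 1, since partial derivatives have one degree less
  than \<open>F\<close>. As \<open>P\<close> has degree \<open>s\<close>, the syzygies are again a
  copy of the forms of degree e + 1 - s.\<close>

lemma dim_N:
  shows "vectorspace.fin_dim base_field (vsp sc2 (N e))"
    and "vectorspace.dim base_field (vsp sc2 (N e)) + nat (e + 2 - int s) = nat (e + 2) + 2 * nat (e + 1)"
proof -
  let ?T = "\<lambda>(g, u, v). (F * u + g * D0 F, F * v + g * D1 F)" and ?S = "\<lambda>k. (P * k, - (A * k), - (B * k))"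
  let ?V = "vsp sc3 (forms (e + 1) \<times> forms e \<times> forms e)"
  have T: "linear_map base_field ?V (vsp sc2 (N e)) ?T"
    by (intro linear_mapI vectorspace_N vectorspace_forms3) (auto simp: algebra_simps N_def)
  have Bk: "B * k \<in> forms e" "A * k \<in> forms e" "P * k \<in> forms (e + 1)" if "k \<in> forms (e + 1 - int s)" for k
    using forms_mult[OF B_forms that] forms_mult[OF A_forms that] forms_mult[OF P_forms that] by simp_all
  have S: "linear_map base_field (vsp sc (forms (e + 1 - int s))) ?V ?S"
    by (intro linear_mapI vectorspace_forms vectorspace_forms3)
      (auto simp: distrib_left mult.left_commute[of _ "const _"] Bk forms_uminus)
  have inj: "inj_on ?S (carrier (vsp sc (forms (e + 1 - int s))))"
    using B_nz by (auto simp: inj_on_def)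
  have ker: "?S ` carrier (vsp sc (forms (e + 1 - int s))) =
      {v \<in> carrier ?V. ?T v = \<zero>\<^bsub>vsp sc2 (N e)\<^esub>}"
  proof (intro equalityI subsetI)
    fix x assume "x \<in> ?S ` carrier (vsp sc (forms (e + 1 - int s)))"
    then obtain k where k: "k \<in> forms (e + 1 - int s)" and x: "x = ?S k" by auto
    have "F * - (A * k) + P * k * D0 F = 0 \<and> F * - (B * k) + P * k * D1 F = 0"
      using syzygy3[OF Bk(3)[OF k], of "- (A * k)" "- (B * k)"] k by blast
    then show "x \<in> {v \<in> carrier ?V. ?T v = \<zero>\<^bsub>vsp sc2 (N e)\<^esub>}"
      unfolding x using Bk[OF k] forms_uminus[OF Bk(1)[OF k]] forms_uminus[OF Bk(2)[OF k]]
      by (simp add: zero_prod_def)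
  next
    fix x assume "x \<in> {v \<in> carrier ?V. ?T v = \<zero>\<^bsub>vsp sc2 (N e)\<^esub>}"
    then obtain g u v where x: "x = (g, u, v)" and g: "g \<in> forms (e + 1)"
      and "F * u + g * D0 F = 0 \<and> F * v + g * D1 F = 0" by (auto simp: zero_prod_def)
    then obtain k where "k \<in> forms (e + 1 - int s)" "g = P * k" "u = - (A * k)" "v = - (B * k)"
      using syzygy3[OF g] by blast
    then show "x \<in> ?S ` carrier (vsp sc (forms (e + 1 - int s)))"
      unfolding x by (intro image_eqI[of _ _ k]) simp_all
  qed
  have surj: "?T ` carrier ?V = carrier (vsp sc2 (N e))"
    by (simp add: N_def)
  note ex = dim_exact[OF T coord_space_dim(1)[OF coord_space_forms3] surj S
      coord_space_dim(1)[OF coord_space_forms] inj ker]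
  show "vectorspace.fin_dim base_field (vsp sc2 (N e))" by (rule ex(1))
  show "vectorspace.dim base_field (vsp sc2 (N e)) + nat (e + 2 - int s) = nat (e + 2) + 2 * nat (e + 1)"
    using ex(2) unfolding coord_space_dim(2)[OF coord_space_forms3] coord_space_dim(2)[OF coord_space_forms]
    by (simp add: algebra_simps)
qed

end

section \<open>Hilbert functions of quotients\<close>

text \<open>Every element is a finite sum of scaled generators. The inner induction is over a finite
  set containing the support, and each step splits off the value at one point.\<close>

lemma free_module_induct [consumes 2, case_names zero add gen]:
  fixes R (structure)
  assumes "cring R" and "f \<in> carrier (free_module R B)"
    and zero: "\<P> (\<lambda>x. \<zero>)"
    and add: "\<And>f g. f \<in> carrier (free_module R B) \<Longrightarrow> g \<in> carrier (free_module R B) \<Longrightarrow>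
      \<P> f \<Longrightarrow> \<P> g \<Longrightarrow> \<P> (f \<oplus>\<^bsub>free_module R B\<^esub> g)"
    and gen: "\<And>r x. r \<in> carrier R \<Longrightarrow> x \<in> B \<Longrightarrow> \<P> (r \<odot>\<^bsub>free_module R B\<^esub> free_gen R x)"
  shows "\<P> f"
proof -
  interpret cring R by fact
  interpret L: Module.module R "free_module R B" by (rule module_free_module) fact
  have fin: "finite {x. f x \<noteq> \<zero>}" using assms(2) by (simp add: free_module_def)
  have "\<P> f" if "{x. f x \<noteq> \<zero>} \<subseteq> A" "finite A" "f \<in> carrier (free_module R B)" for A f
    using that(2,1,3)
  proof (induction A arbitrary: f rule: finite_induct)
    case empty
    then have "f = (\<lambda>x. \<zero>)" by auto
    then show ?case using assms(3) by simp
  next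
    case (insert x A)
    show ?case
    proof (cases "x \<in> B")
      case False
      then have "f x = \<zero>" using insert.prems(2) by (simp add: free_module_def)
      then show ?thesis using insert.prems by (intro insert.IH) auto
    next
      case True
      have car: "f y \<in> carrier R" for y using insert.prems(2) by (simp add: free_module_def)
      let ?g = "f(x := \<zero>)"
      have "{y. ?g y \<noteq> \<zero>} \<subseteq> {y. f y \<noteq> \<zero>}" by auto
      then have fin: "finite {y. ?g y \<noteq> \<zero>}"
        by (rule finite_subset) (use insert.prems(2) in \<open>simp add: free_module_def\<close>)
      have g: "?g \<in> carrier (free_module R B)"
        using insert.prems(2) fin by (simp add: free_module_def)
      have "{y. ?g y \<noteq> \<zero>} \<subseteq> A" using insert.prems(1) by auto
      then have "\<P> ?g" using g by (rule insert.IH)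
      moreover have "f = ?g \<oplus>\<^bsub>free_module R B\<^esub> (f x \<odot>\<^bsub>free_module R B\<^esub> free_gen R x)"
        using car by (auto simp: free_module_def free_gen_def)
      moreover have "f x \<odot>\<^bsub>free_module R B\<^esub> free_gen R x \<in> carrier (free_module R B)"
        using car free_gen_closed[OF assms(1) True] by simp
      ultimately show ?thesis using assms(4)[OF g] assms(5)[OF car True] by metis
    qed
  qed
  from this[of f "{x. f x \<noteq> \<zero>}"] fin assms(2) show ?thesis by simp
qed

text \<open>Graded parts are defined as spans. The image of \<open>U\<close> is a submodule
  containing the spanning set and contained in the span, so it is the whole part;
  \<open>dim_exact\<close> for \<open>V\<close>, \<open>U\<close> and this image then gives the
  count.\<close>

lemma hilbert_fun_quotient:
  fixes M :: "('r, 'v, 'm) module_scheme" and sc' :: "'k::field_char_0 \<Rightarrow> 'w::ab_group_add \<Rightarrow> 'w"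
  assumes M: "Module.module R M" and hom: "\<phi> \<in> Ring.ring_hom base_field R"
    and U: "vectorspace base_field (vsp sc' U)" "vectorspace.fin_dim base_field (vsp sc' U)"
    and V: "vectorspace base_field (vsp sc' V)" "vectorspace.fin_dim base_field (vsp sc' V)"
    and closed: "\<And>u. u \<in> U \<Longrightarrow> \<Phi> u \<in> carrier M"
    and add: "\<And>u v. u \<in> U \<Longrightarrow> v \<in> U \<Longrightarrow> \<Phi> (u + v) = \<Phi> u \<oplus>\<^bsub>M\<^esub> \<Phi> v"
    and smult: "\<And>c u. u \<in> U \<Longrightarrow> \<Phi> (sc' c u) = \<phi> c \<odot>\<^bsub>M\<^esub> \<Phi> u"
    and ker: "V = {u \<in> U. \<Phi> u = \<zero>\<^bsub>M\<^esub>}"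
    and gr: "gr i = LinearCombinations.module.span base_field (restrict_scalars \<phi> M) S"
    and gen: "S \<subseteq> \<Phi> ` U" and im: "\<And>u. u \<in> U \<Longrightarrow> \<Phi> u \<in> gr i"
  shows "gr i = \<Phi> ` U" and "hilbert_fun base_field \<phi> M gr i + vectorspace.dim base_field (vsp sc' V) =
    vectorspace.dim base_field (vsp sc' U)"
proof -
  let ?M = "restrict_scalars \<phi> M"
  interpret U: vectorspace base_field "vsp sc' U" by fact
  interpret M: Module.module base_field ?M
    by (rule module_restrict_scalars[OF U.is_cring M hom])
  have Msimps: "carrier ?M = carrier M" "v \<oplus>\<^bsub>?M\<^esub> w = v \<oplus>\<^bsub>M\<^esub> w" "\<zero>\<^bsub>?M\<^esub> = \<zero>\<^bsub>M\<^esub>"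
    "c \<odot>\<^bsub>?M\<^esub> v = \<phi> c \<odot>\<^bsub>M\<^esub> v" for v w c
    by (simp_all add: restrict_scalars_def)
  interpret vsM: vectorspace base_field ?M
    by (intro vectorspace.intro M.module_axioms field_base_field)
  have sub: "submodule base_field (\<Phi> ` U) ?M"
  proof (rule submodule.intro[OF M.module_axioms])
    show "\<Phi> ` U \<subseteq> carrier ?M" using closed by (auto simp: Msimps)
    fix v w assume "v \<in> \<Phi> ` U" "w \<in> \<Phi> ` U"
    then show "v \<oplus>\<^bsub>?M\<^esub> w \<in> \<Phi> ` U" using add U.M.a_closed by (auto simp: Msimps)
         (metis imageI)
  next
    \<comment> \<open>Additivity on \<open>U\<close> gives \<Phi> 0 + \<Phi> 0 = \<Phi> 0, and
      cancellation identifies \<Phi> 0 as zero.\<close>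
    have "\<Phi> 0 \<oplus>\<^bsub>?M\<^esub> \<Phi> 0 = \<Phi> 0" using add[of 0 0] U.M.zero_closed by (simp add: Msimps)
    moreover have "\<Phi> 0 \<in> carrier ?M" using closed U.M.zero_closed by (simp add: Msimps)
    ultimately have "\<Phi> 0 = \<zero>\<^bsub>?M\<^esub>" using M.M.add.r_cancel_one by blast
    then show "\<zero>\<^bsub>?M\<^esub> \<in> \<Phi> ` U" using U.M.zero_closed by (metis imageI vsp_simps(1,2))
  next
    fix c v assume "v \<in> \<Phi> ` U"
    then obtain u where "u \<in> U" "v = \<Phi> u" by auto
    then show "c \<odot>\<^bsub>?M\<^esub> v \<in> \<Phi> ` U" using smult[of u c] U.smult_closed[of c u]
      by (simp add: Msimps) (metis imageI)
  qed
  show grU: "gr i = \<Phi> ` U"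
  proof
    show "gr i \<subseteq> \<Phi> ` U" unfolding gr by (rule M.span_is_subset[OF gen sub])
    show "\<Phi> ` U \<subseteq> gr i" using im by auto
  qed
  let ?W = "?M\<lparr>carrier := \<Phi> ` U\<rparr>"
  have W: "vectorspace base_field ?W"
    by (intro vectorspace.intro M.submodule_is_module sub field_base_field)
  have T: "linear_map base_field (vsp sc' U) ?W \<Phi>"
    by (intro linear_mapI U W) (auto simp: Msimps add smult)
  have S: "linear_map base_field (vsp sc' V) (vsp sc' U) (\<lambda>v. v)"
    by (intro linear_mapI U V) (auto simp: ker)
  have "vectorspace.dim base_field ?W + vectorspace.dim base_field (vsp sc' V) =
      vectorspace.dim base_field (vsp sc' U)"
    by (rule dim_exact(2)[OF T U(2) _ S V(2)]) (auto simp: ker Msimps)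
  then show "hilbert_fun base_field \<phi> M gr i + vectorspace.dim base_field (vsp sc' V) =
      vectorspace.dim base_field (vsp sc' U)"
    by (simp add: hilbert_fun_def grU)
qed

section \<open>Differentials of the coordinate ring\<close>

context split_form
begin

definition I :: "'k poly poly set" where "I = Idl\<^bsub>P1_ring\<^esub> {F}"

abbreviation "R \<equiv> coord_ring I"

definition cls :: "'k poly poly \<Rightarrow> 'k poly poly set" where "cls p = I +>\<^bsub>P1_ring\<^esub> p"

lemma P1_ring_simps [simp]:
  "carrier (P1_ring :: 'k poly poly ring) = UNIV" "\<zero>\<^bsub>P1_ring :: 'k poly poly ring\<^esub> = 0"
  "\<one>\<^bsub>P1_ring :: 'k poly poly ring\<^esub> = 1"
  "(p :: 'k poly poly) \<oplus>\<^bsub>P1_ring\<^esub> q = p + q" "p \<otimes>\<^bsub>P1_ring\<^esub> q = p * q"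
  by (simp_all add: ring_of_type_algebra_def)

sublocale S: cring "P1_ring :: 'k poly poly ring"
  by (rule cring_from_type_algebra)

lemma ideal_I: "ideal I P1_ring"
  unfolding I_def by (rule S.genideal_ideal) simp

sublocale I: ideal I P1_ring
  by (rule ideal_I)

lemma mem_I: "p \<in> I \<longleftrightarrow> F dvd p"
proof -
  have "I = PIdl\<^bsub>P1_ring\<^esub> F"
    unfolding I_def by (rule S.cgenideal_eq_genideal[symmetric]) simp
  then show ?thesis by (auto simp: cgenideal_def dvd_def mult.commute)
qed

lemma carrier_R: "carrier R = range cls"
  by (auto simp: coord_ring_def FactRing_def A_RCOSETS_def RCOSETS_def a_r_coset_def cls_def)

lemma cls_closed [simp]: "cls p \<in> carrier R"
  by (simp add: carrier_R)

lemma P1_minus: "(p :: 'k poly poly) \<ominus>\<^bsub>P1_ring\<^esub> q = p - q"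
proof -
  have "\<ominus>\<^bsub>P1_ring\<^esub> q = - q" by (rule S.minus_equality) simp_all
  then show ?thesis by (simp add: a_minus_def)
qed

lemma cls_eq_iff: "cls p = cls q \<longleftrightarrow> F dvd p - q"
  using S.quotient_eq_iff_same_a_r_cos[OF ideal_I, of p q]
  by (simp add: cls_def mem_I P1_minus)

lemma cls_add: "cls p \<oplus>\<^bsub>R\<^esub> cls q = cls (p + q)"
  by (simp add: coord_ring_def FactRing_def cls_def I.a_rcos_sum)

lemma cls_mult: "cls p \<otimes>\<^bsub>R\<^esub> cls q = cls (p * q)"
  by (simp add: coord_ring_def FactRing_def cls_def I.rcoset_mult_add)

lemma zero_R: "\<zero>\<^bsub>R\<^esub> = cls 0"
  using S.a_coset_add_zero[of I] by (simp add: coord_ring_def FactRing_def cls_def)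

lemma one_R: "\<one>\<^bsub>R\<^esub> = cls 1"
  by (simp add: coord_ring_def FactRing_def cls_def)

sublocale R: cring R
  unfolding coord_ring_def by (rule I.quotient_is_cring[OF S.is_cring])

lemma cls_minus: "cls p \<ominus>\<^bsub>R\<^esub> cls q = cls (p - q)"
proof -
  have "\<ominus>\<^bsub>R\<^esub> cls q = cls (- q)" by (rule R.minus_equality) (simp_all add: cls_add zero_R)
  then show ?thesis by (simp add: a_minus_def cls_add)
qed

lemma coord_const_eq: "coord_const I c = cls (const c)"
  by (simp add: coord_const_def cls_def)

lemma coord_const_hom: "coord_const I \<in> Ring.ring_hom base_field R"
  by (rule ring_hom_memI) (simp_all add: coord_const_eq cls_add cls_mult one_R)

text \<open>An arbitrary polynomial from each residue class. It respects sums and products only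
  modulo \<open>F\<close>, so multiplying by it yields an action in the sense of
  \<open>module_mod\<close> only.\<close>

definition rep :: "'k poly poly set \<Rightarrow> 'k poly poly" where "rep C = (SOME p. cls p = C)"

lemma cls_rep: "C \<in> carrier R \<Longrightarrow> cls (rep C) = C"
  unfolding rep_def carrier_R by (rule someI_ex) auto

lemma rep_cls: "F dvd rep (cls p) - p"
  using cls_rep[OF cls_closed] cls_eq_iff by simp

definition rels where "rels = {(F * u + g * D0 F, F * v + g * D1 F) | u v g. True}"

definition jac where "jac = {u * D0 F + v * D1 F | u v. True}"

lemma relsI: "p = F * u + g * D0 F \<Longrightarrow> q = F * v + g * D1 F \<Longrightarrow> (p, q) \<in> rels"
  unfolding rels_def by blast

lemma relsE:
  assumes "w \<in> rels"
  obtains u v g where "w = (F * u + g * D0 F, F * v + g * D1 F)"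
  using assms unfolding rels_def by blast

lemma jacI: "p = u * D0 F + v * D1 F \<Longrightarrow> p \<in> jac"
  unfolding jac_def by blast

lemma jacE:
  assumes "p \<in> jac"
  obtains u v where "p = u * D0 F + v * D1 F"
  using assms unfolding jac_def by blast

definition act2 where "act2 C w = (rep C * fst w, rep C * snd w)"

lemma dvd_rels: "F dvd r \<Longrightarrow> (r * p, r * q) \<in> rels"
  by (elim dvdE) (auto intro!: relsI[where g = 0])

text \<open>Euler's formula puts \<open>F\<close> into the Jacobian ideal. Errors of
  \<open>rep\<close> are multiples of \<open>F\<close>, so they are absorbed by \<open>jac\<close>
  and the coordinate ring acts on polynomials modulo \<open>jac\<close>.\<close>

lemma F_mult_jac: "F * p \<in> jac"
proof -
  define i where "i = const (inverse (of_int \<mu> :: 'k))"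
  have "F * p = (i * X0 * D0 F + i * X1 * D1 F) * p"
    using F_in_J unfolding i_def by simp
  then show ?thesis by (intro jacI[of _ "i * X0 * p" "i * X1 * p"]) (simp add: algebra_simps)
qed

lemma dvd_jac: "F dvd r \<Longrightarrow> r * p \<in> jac"
  using F_mult_jac by (elim dvdE) (simp add: mult.assoc)

lemma rels_mult: "w \<in> rels \<Longrightarrow> (r * fst w, r * snd w) \<in> rels"
proof (elim relsE)
  fix u v g assume w: "w = (F * u + g * D0 F, F * v + g * D1 F)"
  show "(r * fst w, r * snd w) \<in> rels"
    by (rule relsI[of _ "r * u" "r * g" _ "r * v"]) (simp_all add: w algebra_simps)
qed

lemma rels_diff:
  assumes "v \<in> rels" "w \<in> rels"
  shows "v - w \<in> rels"
proof -
  obtain a b c where v: "v = (F * a + c * D0 F, F * b + c * D1 F)" using assms(1) by (rule relsE)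
  obtain a' b' c' where w: "w = (F * a' + c' * D0 F, F * b' + c' * D1 F)" using assms(2) by (rule relsE)
  show ?thesis unfolding v w
    by (simp, rule relsI[of _ "a - a'" "c - c'" _ "b - b'"]) (simp_all add: algebra_simps)
qed

lemma jac_diff:
  assumes "v \<in> jac" "w \<in> jac"
  shows "v - w \<in> jac"
proof -
  obtain a b where v: "v = a * D0 F + b * D1 F" using assms(1) by (rule jacE)
  obtain a' b' where w: "w = a' * D0 F + b' * D1 F" using assms(2) by (rule jacE)
  show ?thesis unfolding v w
    by (rule jacI[of _ "a - a'" "b - b'"]) (simp add: algebra_simps)
qed

lemma jac_mult: "w \<in> jac \<Longrightarrow> r * w \<in> jac"
proof (elim jacE)
  fix u v assume w: "w = u * D0 F + v * D1 F"
  show "r * w \<in> jac"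
    by (rule jacI[of _ "r * u" "r * v"]) (simp add: w algebra_simps)
qed

lemma rep_add:
  assumes "C \<in> carrier R" "D \<in> carrier R"
  shows "F dvd rep (C \<oplus>\<^bsub>R\<^esub> D) - (rep C + rep D)"
proof -
  have "C \<oplus>\<^bsub>R\<^esub> D = cls (rep C + rep D)"
    using cls_rep assms by (metis cls_add)
  then show ?thesis using rep_cls by simp
qed

lemma rep_mult:
  assumes "C \<in> carrier R" "D \<in> carrier R"
  shows "F dvd rep (C \<otimes>\<^bsub>R\<^esub> D) - rep C * rep D"
proof -
  have "C \<otimes>\<^bsub>R\<^esub> D = cls (rep C * rep D)"
    using cls_rep assms by (metis cls_mult)
  then show ?thesis using rep_cls by simp
qed

lemma rep_one: "F dvd rep \<one>\<^bsub>R\<^esub> - 1"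
  unfolding one_R by (rule rep_cls)

sublocale N: module_mod R act2 rels
proof
  show "0 \<in> rels" unfolding zero_prod_def by (rule relsI[of _ 0 0 _ 0]) simp_all
  show "v - w \<in> rels" if "v \<in> rels" "w \<in> rels" for v w using that by (rule rels_diff)
  show "act2 r w \<in> rels" if "w \<in> rels" for r w unfolding act2_def using that by (rule rels_mult)
  show "act2 r (v + w) = act2 r v + act2 r w" for r v w
    by (simp add: act2_def algebra_simps)
  show "act2 (r \<oplus>\<^bsub>R\<^esub> s) w - (act2 r w + act2 s w) \<in> rels"
    if "r \<in> carrier R" "s \<in> carrier R" for r s w
    using dvd_rels[OF rep_add[OF that], of "fst w" "snd w"] by (simp add: act2_def algebra_simps)
  show "act2 (r \<otimes>\<^bsub>R\<^esub> s) w - act2 r (act2 s w) \<in> rels"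
    if "r \<in> carrier R" "s \<in> carrier R" for r s w
    using dvd_rels[OF rep_mult[OF that], of "fst w" "snd w"] by (simp add: act2_def algebra_simps)
  show "act2 \<one>\<^bsub>R\<^esub> w - w \<in> rels" for w
    using dvd_rels[OF rep_one, of "fst w" "snd w"] by (cases w) (simp add: act2_def algebra_simps)
qed

sublocale J: module_mod R "\<lambda>C p. rep C * p" jac
proof
  show "0 \<in> jac" by (rule jacI[of _ 0 0]) simp
  show "v - w \<in> jac" if "v \<in> jac" "w \<in> jac" for v w using that by (rule jac_diff)
  show "rep r * w \<in> jac" if "w \<in> jac" for r w using that by (rule jac_mult)
  show "rep r * (v + w) = rep r * v + rep r * w" for r v w
    by (simp add: algebra_simps)
  show "rep (r \<oplus>\<^bsub>R\<^esub> s) * w - (rep r * w + rep s * w) \<in> jac"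
    if "r \<in> carrier R" "s \<in> carrier R" for r s w
    using dvd_jac[OF rep_add[OF that], of w] by (simp add: algebra_simps)
  show "rep (r \<otimes>\<^bsub>R\<^esub> s) * w - rep r * (rep s * w) \<in> jac"
    if "r \<in> carrier R" "s \<in> carrier R" for r s w
    using dvd_jac[OF rep_mult[OF that], of w] by (simp add: algebra_simps)
  show "rep \<one>\<^bsub>R\<^esub> * w - w \<in> jac" for w
    using dvd_jac[OF rep_one, of w] by (simp add: algebra_simps)
qed

sublocale K: cring "base_field :: 'k ring"
  by (rule cring_from_type_algebra)

sublocale O: algebra_hom base_field R "coord_const I"
  by unfold_locales (rule coord_const_hom)

section \<open>Presentation of \<Omega>^1 by dx0 and dx1\<close>

abbreviation "\<Omega> \<equiv> Omega1 I"

lemma Omega_eq: "\<Omega> = kaehler base_field (coord_const I) R"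
  by (simp add: Omega1_def)

sublocale \<Omega>: Module.module R \<Omega>
  unfolding Omega_eq by (rule O.\<Omega>.module_axioms)

abbreviation dR where "dR \<equiv> kaehler_d base_field (coord_const I) R"

lemma d_closed [simp]: "dR (cls p) \<in> carrier \<Omega>"
  unfolding Omega_eq by simp

definition \<Phi> where "\<Phi> w = cls (fst w) \<odot>\<^bsub>\<Omega>\<^esub> dR (cls X0) \<oplus>\<^bsub>\<Omega>\<^esub> cls (snd w) \<odot>\<^bsub>\<Omega>\<^esub> dR (cls X1)"

lemma \<Phi>_closed [simp]: "\<Phi> w \<in> carrier \<Omega>"
  by (simp add: \<Phi>_def)

lemma \<Phi>_add: "\<Phi> (v + w) = \<Phi> v \<oplus>\<^bsub>\<Omega>\<^esub> \<Phi> w"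
  by (simp add: \<Phi>_def cls_add[symmetric] \<Omega>.smult_l_distr \<Omega>.M.a_ac)

lemma \<Phi>_smult: "cls r \<odot>\<^bsub>\<Omega>\<^esub> \<Phi> w = \<Phi> (r * fst w, r * snd w)"
  by (simp add: \<Phi>_def cls_mult[symmetric] \<Omega>.smult_r_distr \<Omega>.smult_assoc1)

lemma d_cls_add: "dR (cls (p + q)) = dR (cls p) \<oplus>\<^bsub>\<Omega>\<^esub> dR (cls q)"
  using O.d_add[of "cls p" "cls q"] by (simp add: cls_add Omega_eq)

lemma d_cls_mult: "dR (cls (p * q)) = cls p \<odot>\<^bsub>\<Omega>\<^esub> dR (cls q) \<oplus>\<^bsub>\<Omega>\<^esub> cls q \<odot>\<^bsub>\<Omega>\<^esub> dR (cls p)"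
  using O.d_mult[of "cls p" "cls q"] by (simp add: cls_mult Omega_eq)

lemma \<Phi>_0: "\<Phi> 0 = \<zero>\<^bsub>\<Omega>\<^esub>"
  by (simp add: \<Phi>_def zero_R[symmetric])

text \<open>Both sides obey the same rules for sums and products and agree on constants and
  variables. Polynomials are built from these by Horner's scheme, in X0 for the coefficients and
  then in X1.\<close>

lemma d_cls: "dR (cls p) = \<Phi> (D0 p, D1 p)"
proof -
  have const: "dR (cls (const c)) = \<Phi> (D0 (const c), D1 (const c))" for c
    using O.d_const[of c] \<Phi>_0 by (simp add: coord_const_eq Omega_eq zero_prod_def)
  have add: "dR (cls (p + q)) = \<Phi> (D0 (p + q), D1 (p + q))"
    if "dR (cls p) = \<Phi> (D0 p, D1 p)" "dR (cls q) = \<Phi> (D0 q, D1 q)" for p q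
    using that by (simp add: d_cls_add D0_add D1_add \<Phi>_add[symmetric])
  have mult: "dR (cls (p * q)) = \<Phi> (D0 (p * q), D1 (p * q))"
    if "dR (cls p) = \<Phi> (D0 p, D1 p)" "dR (cls q) = \<Phi> (D0 q, D1 q)" for p q
    using that by (simp add: d_cls_mult D0_mult D1_mult \<Phi>_add[symmetric] \<Phi>_smult)
  have X0: "dR (cls X0) = \<Phi> (D0 X0, D1 X0)" and X1: "dR (cls X1) = \<Phi> (D0 X1, D1 X1)"
    by (simp_all add: \<Phi>_def one_R[symmetric] zero_R[symmetric])
  have K0: "dR (cls [:b:]) = \<Phi> (D0 [:b:], D1 [:b:])" for b
  proof (induction b)
    case 0
    then show ?case using const[of 0] by simp
  next
    case (pCons c b)
    have "[:pCons c b:] = const c + X0 * [:b:]" by (simp add: const_def X0_def)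
    then show ?case using add[OF const mult[OF X0 pCons.IH]] by simp
  qed
  show ?thesis
  proof (induction p)
    case 0
    then show ?case using const[of 0] by simp
  next
    case (pCons b p)
    have "pCons b p = [:b:] + X1 * p" by (simp add: X1_def)
    then show ?case using add[OF K0 mult[OF X1 pCons.IH]] by simp
  qed
qed

text \<open>The gradient of the chosen representative, as value of the symbol dC. Changing the
  representative by F k changes the gradient by F dk + k dF, an element of \<open>rels\<close>;
  hence \<open>t1\<close> is a derivation modulo \<open>rels\<close>.\<close>

definition t1 where "t1 C = (D0 (rep C), D1 (rep C))"

lemma D_dvd_rels: "F dvd r \<Longrightarrow> (D0 r, D1 r) \<in> rels"
  by (elim dvdE) (auto simp: D0_mult D1_mult intro!: relsI)

lemma t1_cong: "F dvd rep C - p \<Longrightarrow> N.cong_N (t1 C) (D0 p, D1 p)"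
  using D_dvd_rels[of "rep C - p"] by (simp add: t1_def N.cong_N_def D0_diff D1_diff)

lemma act2_cls: "N.cong_N (act2 (cls p) w) (p * fst w, p * snd w)"
  using dvd_rels[OF rep_cls, of p "fst w" "snd w"] by (simp add: act2_def N.cong_N_def algebra_simps)

lemma ev_kaehler: "f \<in> kaehler_submodule base_field (coord_const I) R \<Longrightarrow> N.ev t1 f \<in> rels"
proof (rule N.ev_kaehler_submodule)
  show "algebra_hom base_field R (coord_const I)" by (rule O.algebra_hom_axioms)
  show "N.cong_N (t1 (r \<oplus>\<^bsub>R\<^esub> s)) (t1 r + t1 s)" if "r \<in> carrier R" "s \<in> carrier R" for r s
    using t1_cong[OF rep_add[OF that]] by (simp add: t1_def D0_add D1_add)
  show "N.cong_N (t1 (r \<otimes>\<^bsub>R\<^esub> s)) (act2 r (t1 s) + act2 s (t1 r))"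
    if "r \<in> carrier R" "s \<in> carrier R" for r s
    using t1_cong[OF rep_mult[OF that]] by (simp add: t1_def D0_mult D1_mult act2_def)
  show "t1 (coord_const I c) \<in> rels" for c
    using N.cong_mem[OF t1_cong[OF rep_cls, of "const c"]] N.zero_N
    by (simp add: coord_const_eq zero_prod_def)
qed

text \<open>If the combination with coordinates \<open>w\<close> vanishes, its lift to the free
  module on all symbols is a consequence of the Kaehler relations, and evaluating the lift by
  \<open>t1\<close> returns \<open>w\<close> modulo \<open>rels\<close>. Conversely \<open>F\<close>
  is zero in the ring, and so is its differential.\<close>

lemma \<Phi>_eq_0_iff: "\<Phi> w = \<zero>\<^bsub>\<Omega>\<^esub> \<longleftrightarrow> w \<in> rels"
proof
  assume 0: "\<Phi> w = \<zero>\<^bsub>\<Omega>\<^esub>"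
  let ?L = "free_module R (carrier R)"
  let ?x = "cls (fst w) \<odot>\<^bsub>?L\<^esub> free_gen R (cls X0)" and ?y = "cls (snd w) \<odot>\<^bsub>?L\<^esub> free_gen R (cls X1)"
  have "\<Phi> w = O.quot.cls (?x \<oplus>\<^bsub>?L\<^esub> ?y)"
    by (simp add: \<Phi>_def Omega_eq O.kaehler_eq O.d_eq O.quot.cls_add O.quot.cls_smult)
  then have "?x \<oplus>\<^bsub>?L\<^esub> ?y \<in> kaehler_submodule base_field (coord_const I) R"
    using 0 O.quot.cls_eq_zero_iff[of "?x \<oplus>\<^bsub>?L\<^esub> ?y"] by (simp add: Omega_eq O.kaehler_eq)
  then have "N.ev t1 (?x \<oplus>\<^bsub>?L\<^esub> ?y) \<in> rels" by (rule ev_kaehler)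
  \<comment> \<open>The symbols of x0 and x1 evaluate to the gradients (1, 0) and (0, 1), up to
    \<open>rels\<close>.\<close>
  moreover have "N.cong_N (N.ev t1 (?x \<oplus>\<^bsub>?L\<^esub> ?y)) (act2 (cls (fst w)) (1, 0) + act2 (cls (snd w)) (0, 1))"
  proof (rule N.ev_add_cong)
    have "N.cong_N (N.ev t1 (free_gen R (cls p))) (D0 p, D1 p)" for p
      using N.cong_trans[OF N.ev_free_gen[of t1] t1_cong[OF rep_cls]] .
    from this[of X0] this[of X1]
    show "N.cong_N (N.ev t1 ?x) (act2 (cls (fst w)) (1, 0))"
      "N.cong_N (N.ev t1 ?y) (act2 (cls (snd w)) (0, 1))"
      by (auto intro!: N.ev_smult_cong)
  qed simp_all
  moreover have "N.cong_N (act2 (cls (fst w)) (1, 0) + act2 (cls (snd w)) (0, 1)) w"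
    using N.cong_add[OF act2_cls[of "fst w" "(1, 0)"] act2_cls[of "snd w" "(0, 1)"]] by simp
  ultimately show "w \<in> rels" using N.cong_mem by blast
next
  assume "w \<in> rels"
  then obtain u v g where w: "w = (F * u + g * D0 F, F * v + g * D1 F)" by (rule relsE)
  have clsF: "cls F = \<zero>\<^bsub>R\<^esub>" by (simp add: zero_R cls_eq_iff)
  have "\<Phi> (D0 F, D1 F) = dR (cls 0)"
    unfolding d_cls[symmetric] clsF zero_R ..
  also have "\<dots> = \<zero>\<^bsub>\<Omega>\<^esub>" unfolding d_cls using \<Phi>_0 by (simp add: zero_prod_def)
  finally have dF: "\<Phi> (D0 F, D1 F) = \<zero>\<^bsub>\<Omega>\<^esub>" .
  have "w = (F * u, F * v) + (g * D0 F, g * D1 F)" by (simp add: w)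
  then have "\<Phi> w = cls F \<odot>\<^bsub>\<Omega>\<^esub> \<Phi> (u, v) \<oplus>\<^bsub>\<Omega>\<^esub> cls g \<odot>\<^bsub>\<Omega>\<^esub> \<Phi> (D0 F, D1 F)"
    by (simp add: w \<Phi>_smult \<Phi>_add[symmetric])
  then show "\<Phi> w = \<zero>\<^bsub>\<Omega>\<^esub>" by (simp add: clsF dF)
qed

text \<open>Comparing components of degree \<open>d\<close> replaces arbitrary cofactors by
  homogeneous ones: \<open>F\<close> has degree \<mu> and its partial derivatives \<mu> - 1, so
  \<open>u\<close> and \<open>v\<close> go to degree d - \<mu> and \<open>g\<close> to d - \<mu> +
  1.\<close>

lemma rels_graded:
  assumes "p \<in> forms d" "q \<in> forms d"
  shows "(p, q) \<in> rels \<longleftrightarrow> (p, q) \<in> N (d - \<mu>)"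
proof
  assume "(p, q) \<in> rels"
  then obtain u v g where pq: "p = F * u + g * D0 F" "q = F * v + g * D1 F" by (elim relsE) auto
  have D: "D0 F \<in> forms (\<mu> - 1)" "D1 F \<in> forms (\<mu> - 1)"
    using F_forms by (simp_all add: D0_forms D1_forms)
  have "p = hcomp d (F * u + D0 F * g)" "q = hcomp d (F * v + D1 F * g)"
    using hcomp_eq[OF assms(1)] hcomp_eq[OF assms(2)] pq by (simp_all add: mult.commute)
  then have "p = F * hcomp (d - \<mu>) u + hcomp (d - \<mu> + 1) g * D0 F"
    "q = F * hcomp (d - \<mu>) v + hcomp (d - \<mu> + 1) g * D1 F"
    by (simp_all add: hcomp_add hcomp_mult[OF F_forms] hcomp_mult[OF D(1)] hcomp_mult[OF D(2)]
        mult.commute[of "hcomp (d - \<mu> + 1) g"] diff_diff_eq2 diff_add_eq)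
  then show "(p, q) \<in> N (d - \<mu>)"
    unfolding N_def
    by (intro image_eqI[of _ _ "(hcomp (d - \<mu> + 1) g, hcomp (d - \<mu>) u, hcomp (d - \<mu>) v)"])
      (auto simp: hcomp_forms)
next
  assume "(p, q) \<in> N (d - \<mu>)"
  then show "(p, q) \<in> rels" by (auto simp: N_def rels_def)
qed

lemma N_forms: "N (d - \<mu>) \<subseteq> forms d \<times> forms d"
proof -
  have D: "D0 F \<in> forms (\<mu> - 1)" "D1 F \<in> forms (\<mu> - 1)"
    using F_forms by (simp_all add: D0_forms D1_forms)
  have "F * u + g * D0 F \<in> forms d" "F * u + g * D1 F \<in> forms d"
    if "g \<in> forms (d - \<mu> + 1)" "u \<in> forms (d - \<mu>)" for g u
    using forms_mult[OF F_forms that(2)] forms_mult[OF that(1) D(1)] forms_mult[OF that(1) D(2)]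
    by (auto intro!: forms_add)
  then show ?thesis by (auto simp: N_def)
qed

lemma Omega1_part_eq:
  "Omega1_part I i = LinearCombinations.module.span base_field (restrict_scalars (coord_const I) \<Omega>)
    {f \<odot>\<^bsub>\<Omega>\<^esub> dR g | f g a b. f \<in> coord_part I a \<and> g \<in> coord_part I b \<and> a + b = i}"
  by (simp add: Omega1_part_def kaehler_part_def Omega_eq)

lemma coord_part_eq: "coord_part I i = cls ` forms i"
  by (simp add: coord_part_def cls_def)

sublocale K\<Omega>: Module.module base_field "restrict_scalars (coord_const I) \<Omega>"
  by (rule module_restrict_scalars[OF K.is_cring \<Omega>.module_axioms coord_const_hom])

lemma restrict_simps [simp]:
  "carrier (restrict_scalars \<phi> M) = carrier M" "v \<oplus>\<^bsub>restrict_scalars \<phi> M\<^esub> w = v \<oplus>\<^bsub>M\<^esub> w"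
  by (simp_all add: restrict_scalars_def)

text \<open>As dx0 and dx1 have degree 1, degree i of \<Omega>^1 has coefficients of degree i - 1. A
  generator f dg lands there by \<open>d_cls\<close>; conversely the two terms of
  \<open>\<Phi> w\<close> are generators with g the class of X0 or X1.\<close>

lemma
  shows Omega1_part_image: "Omega1_part I i = \<Phi> ` (forms (i - 1) \<times> forms (i - 1))"
    and HF_Omega1_dim: "HF_Omega1 I i + vectorspace.dim base_field (vsp sc2 (N (i - 1 - \<mu>))) = 2 * nat i"
proof -
  let ?S = "{f \<odot>\<^bsub>\<Omega>\<^esub> dR g | f g a b. f \<in> coord_part I a \<and> g \<in> coord_part I b \<and> a + b = i}"
  let ?U = "forms (i - 1) \<times> forms (i - 1)"
  have S_closed: "?S \<subseteq> carrier \<Omega>" by (auto simp: coord_part_eq)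
  have gen: "?S \<subseteq> \<Phi> ` ?U"
  proof
    fix x assume "x \<in> ?S"
    then obtain p q a b where pq: "p \<in> forms a" "q \<in> forms b" "a + b = i"
      and x: "x = cls p \<odot>\<^bsub>\<Omega>\<^esub> dR (cls q)" by (auto simp: coord_part_eq)
    have "x = \<Phi> (p * D0 q, p * D1 q)" unfolding x d_cls \<Phi>_smult by simp
    moreover have "p * D0 q \<in> forms (i - 1)" "p * D1 q \<in> forms (i - 1)"
      using forms_mult[OF pq(1) D0_forms[OF pq(2)]] forms_mult[OF pq(1) D1_forms[OF pq(2)]] pq(3)
      by (simp_all add: add_diff_eq)
    ultimately show "x \<in> \<Phi> ` ?U" by blast
  qed
  have im: "\<Phi> w \<in> Omega1_part I i" if "w \<in> ?U" for w
  proof -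
    have in_S: "cls (fst w) \<odot>\<^bsub>\<Omega>\<^esub> dR (cls X0) \<in> ?S" "cls (snd w) \<odot>\<^bsub>\<Omega>\<^esub> dR (cls X1) \<in> ?S"
    proof -
      have "cls (fst w) \<in> coord_part I (i - 1)" "cls (snd w) \<in> coord_part I (i - 1)"
        "cls X0 \<in> coord_part I 1" "cls X1 \<in> coord_part I 1" "i - 1 + 1 = i"
        using that X0_forms X1_forms by (auto simp: coord_part_eq)
      then show "cls (fst w) \<odot>\<^bsub>\<Omega>\<^esub> dR (cls X0) \<in> ?S" "cls (snd w) \<odot>\<^bsub>\<Omega>\<^esub> dR (cls X1) \<in> ?S"
        by blast+
    qed
    have sub: "submodule base_field (K\<Omega>.span ?S) (restrict_scalars (coord_const I) \<Omega>)"
      using S_closed by (intro K\<Omega>.span_is_submodule) simp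
    have own: "?S \<subseteq> K\<Omega>.span ?S" using S_closed by (intro K\<Omega>.in_own_span) simp
    from submodule.m_closed[OF sub subsetD[OF own in_S(1)] subsetD[OF own in_S(2)]]
    have "\<Phi> w \<in> K\<Omega>.span ?S" unfolding \<Phi>_def restrict_simps(2) .
    then show ?thesis unfolding Omega1_part_eq .
  qed
  have ker: "N (i - 1 - \<mu>) = {w \<in> ?U. \<Phi> w = \<zero>\<^bsub>\<Omega>\<^esub>}"
    using N_forms[of "i - 1"] rels_graded[of _ "i - 1"] by (auto simp: \<Phi>_eq_0_iff)
  have smult: "\<Phi> (sc2 c u) = coord_const I c \<odot>\<^bsub>\<Omega>\<^esub> \<Phi> u" for c u
    by (cases u) (simp add: coord_const_eq \<Phi>_smult)
  note hf = hilbert_fun_quotient[where \<Phi> = \<Phi> and gr = "Omega1_part I" and i = i and S = ?S,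
    OF \<Omega>.module_axioms coord_const_hom vectorspace_forms2
    coord_space_dim(1)[OF coord_space_forms2] vectorspace_N dim_N(1)
    \<Phi>_closed \<Phi>_add smult ker Omega1_part_eq gen im]
  show "Omega1_part I i = \<Phi> ` ?U" by (rule hf(1))
  show "HF_Omega1 I i + vectorspace.dim base_field (vsp sc2 (N (i - 1 - \<mu>))) = 2 * nat i"
    using hf(2) unfolding coord_space_dim(2)[OF coord_space_forms2] by (simp add: HF_Omega1_def)
qed

text \<open>By \<open>d_cls\<close> every r dy already lies in the range of \<Phi>, and additivity
  extends this to their sums.\<close>

lemma carrier_Omega: "carrier \<Omega> = range \<Phi>"
proof
  show "carrier \<Omega> \<subseteq> range \<Phi>"
  proof
    fix x assume "x \<in> carrier \<Omega>"
    then obtain f where f: "f \<in> carrier (free_module R (carrier R))" and x: "x = O.quot.cls f"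
      by (auto simp: Omega_eq O.kaehler_eq O.quot.carrier_Q)
    from R.is_cring f have "O.quot.cls f \<in> range \<Phi>"
    proof (induction rule: free_module_induct)
      case zero
      have "\<zero>\<^bsub>free_module R (carrier R)\<^esub> = (\<lambda>x. \<zero>\<^bsub>R\<^esub>)" by (simp add: free_module_def)
      then have "O.quot.cls (\<lambda>x. \<zero>\<^bsub>R\<^esub>) = \<Phi> 0"
        using O.quot.cls_zero \<Phi>_0 by (simp add: Omega_eq O.kaehler_eq)
      then show ?case by simp
    next
      case (add f g)
      then obtain v w where "O.quot.cls f = \<Phi> v" "O.quot.cls g = \<Phi> w" by auto
      then have "O.quot.cls (f \<oplus>\<^bsub>free_module R (carrier R)\<^esub> g) = \<Phi> (v + w)"
        using O.quot.cls_add[OF add(1,2)] by (simp add: \<Phi>_add Omega_eq O.kaehler_eq)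
      then show ?case by simp
    next
      case (gen r y)
      then obtain p q where pq: "r = cls p" "y = cls q" by (auto simp: carrier_R)
      have "O.quot.cls (r \<odot>\<^bsub>free_module R (carrier R)\<^esub> free_gen R y) = cls p \<odot>\<^bsub>\<Omega>\<^esub> dR (cls q)"
        using O.quot.cls_smult[of r "free_gen R y"] gen by (simp add: pq Omega_eq O.kaehler_eq O.d_eq)
      then show ?case by (simp add: d_cls \<Phi>_smult)
    qed
    then show "x \<in> range \<Phi>" by (simp add: x)
  qed
qed auto

text \<open>Coordinates with respect to \<open>dx0\<close> and \<open>dx1\<close>, unique only modulo \<open>rels\<close>.\<close>

definition coords :: "_ \<Rightarrow> 'k poly poly \<times> 'k poly poly" where "coords v = (SOME w. \<Phi> w = v)"

lemma \<Phi>_coords: "v \<in> carrier \<Omega> \<Longrightarrow> \<Phi> (coords v) = v"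
  unfolding coords_def carrier_Omega by (rule someI_ex) auto

lemma \<Phi>_eq_iff: "\<Phi> v = \<Phi> w \<longleftrightarrow> v - w \<in> rels"
proof -
  have "\<Phi> v = \<Phi> (v - w) \<oplus>\<^bsub>\<Omega>\<^esub> \<Phi> w" by (simp add: \<Phi>_add[symmetric])
  then have "\<Phi> v = \<Phi> w \<longleftrightarrow> \<Phi> (v - w) = \<zero>\<^bsub>\<Omega>\<^esub>"
    using \<Omega>.M.add.r_cancel_one[of "\<Phi> w" "\<Phi> (v - w)"] by auto
  then show ?thesis by (simp add: \<Phi>_eq_0_iff)
qed

definition minor2 :: "'k poly poly \<times> 'k poly poly \<Rightarrow> 'k poly poly \<times> 'k poly poly \<Rightarrow> 'k poly poly" where
  "minor2 v w = fst v * snd w - snd v * fst w"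

lemma minor2_simps:
  "minor2 (u + v) w = minor2 u w + minor2 v w" "minor2 w (u + v) = minor2 w u + minor2 w v"
  "minor2 (u - v) w = minor2 u w - minor2 v w" "minor2 w (u - v) = minor2 w u - minor2 w v"
  "minor2 (r * p, r * q) w = r * minor2 (p, q) w" "minor2 w (r * p, r * q) = r * minor2 w (p, q)"
  "minor2 v v = 0"
  by (simp_all add: minor2_def algebra_simps)

text \<open>The minor of a relation with \<open>w\<close> consists of a multiple of
  \<open>F\<close>, in \<open>jac\<close> by Euler's formula, and the contribution of g dF, a
  combination of the partial derivatives. So minors of coordinates are well defined modulo
  \<open>jac\<close>.\<close>

lemma minor2_rels:
  assumes "v \<in> rels"
  shows "minor2 v w \<in> jac" "minor2 w v \<in> jac"
proof -
  obtain a b g where v: "v = (F * a + g * D0 F, F * b + g * D1 F)" using assms by (rule relsE)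
  have 1: "minor2 v w = F * (a * snd w - b * fst w) - (- (g * snd w) * D0 F + g * fst w * D1 F)"
    by (simp add: minor2_def v algebra_simps)
  have "- (g * snd w) * D0 F + g * fst w * D1 F \<in> jac" by (rule jacI) (rule refl)
  then show 2: "minor2 v w \<in> jac" unfolding 1 by (intro jac_diff F_mult_jac)
  have "minor2 w v = - minor2 v w" by (simp add: minor2_def)
  then show "minor2 w v \<in> jac" using J.uminus_N[OF 2] by simp
qed

lemma minor2_cong:
  assumes "v - v' \<in> rels" "w - w' \<in> rels"
  shows "J.cong_N (minor2 v w) (minor2 v' w')"
proof -
  have "minor2 v w - minor2 v' w' = minor2 (v - v') w + minor2 v' (w - w')"
    by (simp add: minor2_simps)
  then show ?thesis
    using J.add_N[OF minor2_rels(1)[OF assms(1)] minor2_rels(2)[OF assms(2)]] by (simp add: J.cong_N_def)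
qed

section \<open>Presentation of \<Omega>^2 by the single generator dx0 \<and> dx1\<close>

sublocale X: exterior_square R \<Omega>
  by unfold_locales

text \<open>The coefficient that a wedge of two differentials has at dx0 \<and> dx1. With
  \<open>coords_add\<close> and \<open>coords_smult\<close>, \<open>minor2_cong\<close> makes it
  bilinear and alternating modulo \<open>jac\<close>, whatever coordinates are chosen.\<close>

definition t2 where "t2 xs = minor2 (coords (xs ! 0)) (coords (xs ! 1))"

lemma coords_add:
  assumes "v \<in> carrier \<Omega>" "w \<in> carrier \<Omega>"
  shows "coords (v \<oplus>\<^bsub>\<Omega>\<^esub> w) - (coords v + coords w) \<in> rels"
  using assms by (simp add: \<Phi>_eq_iff[symmetric] \<Phi>_coords \<Phi>_add)

lemma coords_smult:
  assumes "r \<in> carrier R" "v \<in> carrier \<Omega>"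
  shows "coords (r \<odot>\<^bsub>\<Omega>\<^esub> v) - (rep r * fst (coords v), rep r * snd (coords v)) \<in> rels"
  using assms by (simp add: \<Phi>_eq_iff[symmetric] \<Phi>_coords \<Phi>_smult[symmetric] cls_rep)

lemma less_2: "i < 2 \<longleftrightarrow> i = 0 \<or> i = (1::nat)"
  by auto

lemma ev_exterior: "f \<in> exterior_submodule R \<Omega> 2 \<Longrightarrow> J.ev t2 f \<in> jac"
proof (rule J.ev_exterior_submodule[OF \<Omega>.module_axioms])
  fix xs i v w assume xs: "xs \<in> tuples \<Omega> 2" and i: "i < (2::nat)"
    and vw: "v \<in> carrier \<Omega>" "w \<in> carrier \<Omega>"
  obtain y z where yz: "xs = [y, z]" "y \<in> carrier \<Omega>" "z \<in> carrier \<Omega>" using xs by (rule X.tuples_2E)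
  show "J.cong_N (t2 (xs[i := v \<oplus>\<^bsub>\<Omega>\<^esub> w])) (t2 (xs[i := v]) + t2 (xs[i := w]))"
  proof (cases "i = 0")
    case True
    then show ?thesis
      using minor2_cong[OF coords_add[OF vw], of "coords z" "coords z"] N.zero_N
      by (simp add: t2_def yz minor2_simps)
  next
    case False
    then have "i = 1" using i by simp
    then show ?thesis
      using minor2_cong[OF _ coords_add[OF vw], of "coords y" "coords y"] N.zero_N
      by (simp add: t2_def yz minor2_simps)
  qed
next
  fix xs i r v assume xs: "xs \<in> tuples \<Omega> 2" and i: "i < (2::nat)"
    and rv: "r \<in> carrier R" "v \<in> carrier \<Omega>"
  obtain y z where yz: "xs = [y, z]" "y \<in> carrier \<Omega>" "z \<in> carrier \<Omega>" using xs by (rule X.tuples_2E)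
  show "J.cong_N (t2 (xs[i := r \<odot>\<^bsub>\<Omega>\<^esub> v])) (rep r * t2 (xs[i := v]))"
  proof (cases "i = 0")
    case True
    then show ?thesis
      using minor2_cong[OF coords_smult[OF rv], of "coords z" "coords z"] N.zero_N
      by (simp add: t2_def yz minor2_simps)
  next
    case False
    then have "i = 1" using i by simp
    then show ?thesis
      using minor2_cong[OF _ coords_smult[OF rv], of "coords y" "coords y"] N.zero_N
      by (simp add: t2_def yz minor2_simps)
  qed
next
  fix xs assume "xs \<in> tuples \<Omega> 2" "\<not> distinct xs"
  then obtain y where "xs = [y, y]" by (elim X.tuples_2E) auto
  then show "t2 xs \<in> jac" using J.zero_N by (simp add: t2_def minor2_simps)
qed

abbreviation "\<Lambda> \<equiv> exterior_power R \<Omega> 2"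

definition \<omega> where "\<omega> = wedge R \<Omega> [dR (cls X0), dR (cls X1)]"

definition \<Psi> where "\<Psi> h = cls h \<odot>\<^bsub>\<Lambda>\<^esub> \<omega>"

lemma \<omega>_eq: "\<omega> = X.wedge2 (dR (cls X0)) (dR (cls X1))"
  by (simp add: \<omega>_def X.wedge2_def)

lemma \<omega>_closed [simp]: "\<omega> \<in> carrier \<Lambda>"
  by (simp add: \<omega>_eq)

lemma \<Psi>_closed [simp]: "\<Psi> h \<in> carrier \<Lambda>"
  by (simp add: \<Psi>_def)

lemma \<Psi>_add: "\<Psi> (g + h) = \<Psi> g \<oplus>\<^bsub>\<Lambda>\<^esub> \<Psi> h"
  by (simp add: \<Psi>_def cls_add[symmetric] X.\<Lambda>.smult_l_distr)

lemma \<Psi>_smult: "cls r \<odot>\<^bsub>\<Lambda>\<^esub> \<Psi> h = \<Psi> (r * h)"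
  by (simp add: \<Psi>_def cls_mult[symmetric] X.\<Lambda>.smult_assoc1)

lemma wedge_\<Phi>: "X.wedge2 (\<Phi> v) (\<Phi> w) = \<Psi> (minor2 v w)"
  unfolding \<Phi>_def \<Psi>_def minor2_def \<omega>_eq
  by (subst X.wedge2_lincomb) (simp_all add: cls_mult cls_minus)

lemma \<Psi>_eq_0_iff: "\<Psi> h = \<zero>\<^bsub>\<Lambda>\<^esub> \<longleftrightarrow> h \<in> jac"
proof
  assume 0: "\<Psi> h = \<zero>\<^bsub>\<Lambda>\<^esub>"
  let ?E = "free_module R (tuples \<Omega> 2)" and ?xs = "[dR (cls X0), dR (cls X1)]"
  let ?f = "cls h \<odot>\<^bsub>?E\<^esub> free_gen R ?xs"
  have "\<Psi> h = X.quot.cls ?f"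
    by (simp add: \<Psi>_def \<omega>_eq X.wedge2_eq X.exterior_power_eq X.quot.cls_smult)
  then have "?f \<in> exterior_submodule R \<Omega> 2"
    using 0 X.quot.cls_eq_zero_iff[of ?f] by (simp add: X.exterior_power_eq)
  then have "J.ev t2 ?f \<in> jac" by (rule ev_exterior)
  moreover have "J.cong_N (J.ev t2 ?f) (rep (cls h) * minor2 (1, 0) (0, 1))"
  proof (rule J.ev_smult_cong)
    \<comment> \<open>The chosen coordinates of dx0 and dx1 need not be (1, 0) and (0, 1), but
      differ from them by elements of \<open>rels\<close>.\<close>
    have "J.cong_N (t2 ?xs) (minor2 (1, 0) (0, 1))"
      unfolding t2_def nth_Cons_0 One_nat_def nth_Cons_Suc
      by (rule minor2_cong) (simp_all add: \<Phi>_eq_iff[symmetric] \<Phi>_coords, simp_all add: d_cls)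
    from J.cong_trans[OF J.ev_free_gen[of t2] this]
    show "J.cong_N (J.ev t2 (free_gen R ?xs)) (minor2 (1, 0) (0, 1))" .
  qed simp_all
  moreover have "J.cong_N (rep (cls h) * minor2 (1, 0) (0, 1)) h"
    using dvd_jac[OF rep_cls, of h 1] by (simp add: J.cong_N_def minor2_def)
  ultimately show "h \<in> jac" using J.cong_mem by blast
next
  assume "h \<in> jac"
  then obtain u v where h: "h = u * D0 F + v * D1 F" by (rule jacE)
  have "(D0 F, D1 F) \<in> rels" by (rule relsI[of _ 0 1 _ 0]) simp_all
  then have "\<Phi> (D0 F, D1 F) = \<zero>\<^bsub>\<Omega>\<^esub>" by (simp add: \<Phi>_eq_0_iff)
  \<comment> \<open>In other words, h dx0 \<and> dx1 is dF \<and> (u dx1 - v dx0), and dF =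
    0.\<close>
  moreover have "h = minor2 (D0 F, D1 F) (- v, u)" by (simp add: h minor2_def algebra_simps)
  ultimately have "\<Psi> h = X.wedge2 \<zero>\<^bsub>\<Omega>\<^esub> (\<Phi> (- v, u))" by (simp add: wedge_\<Phi>[symmetric])
  also have "\<dots> = X.wedge2 (\<zero>\<^bsub>R\<^esub> \<odot>\<^bsub>\<Omega>\<^esub> \<zero>\<^bsub>\<Omega>\<^esub>) (\<Phi> (- v, u))" by simp
  also have "\<dots> = \<zero>\<^bsub>\<Lambda>\<^esub>" by (subst X.wedge2_smult_left) simp_all
  finally show "\<Psi> h = \<zero>\<^bsub>\<Lambda>\<^esub>" .
qed

lemma jac_graded:
  assumes "p \<in> forms e"
  shows "p \<in> jac \<longleftrightarrow> p \<in> J (e + 1 - \<mu>)"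
proof
  assume "p \<in> jac"
  then obtain u v where p: "p = u * D0 F + v * D1 F" by (rule jacE)
  have D: "D0 F \<in> forms (\<mu> - 1)" "D1 F \<in> forms (\<mu> - 1)"
    using F_forms by (simp_all add: D0_forms D1_forms)
  have "p = hcomp e (D0 F * u + D1 F * v)"
    using hcomp_eq[OF assms] p by (simp add: mult.commute)
  then have "p = hcomp (e + 1 - \<mu>) u * D0 F + hcomp (e + 1 - \<mu>) v * D1 F"
    by (simp add: hcomp_add hcomp_mult[OF D(1)] hcomp_mult[OF D(2)] mult.commute[of "hcomp _ _" "D0 F"]
        mult.commute[of "hcomp _ _" "D1 F"] diff_diff_eq2)
  then show "p \<in> J (e + 1 - \<mu>)"
    unfolding J_def
    by (intro image_eqI[of _ _ "(hcomp (e + 1 - \<mu>) u, hcomp (e + 1 - \<mu>) v)"]) (auto simp: hcomp_forms)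
next
  assume "p \<in> J (e + 1 - \<mu>)"
  then show "p \<in> jac" by (auto simp: J_def jac_def)
qed

lemma J_forms: "J (e + 1 - \<mu>) \<subseteq> forms e"
proof -
  have D: "D0 F \<in> forms (\<mu> - 1)" "D1 F \<in> forms (\<mu> - 1)"
    using F_forms by (simp_all add: D0_forms D1_forms)
  have "u * D0 F + v * D1 F \<in> forms e"
    if "u \<in> forms (e + 1 - \<mu>)" "v \<in> forms (e + 1 - \<mu>)" for u v
    using forms_mult[OF that(1) D(1)] forms_mult[OF that(2) D(2)]
    by (auto intro!: forms_add)
  then show ?thesis by (auto simp: J_def)
qed

definition Omega2_part where
  "Omega2_part = exterior_part base_field (coord_const I) R (coord_part I) \<Omega> (Omega1_part I) 2"

text \<open>dx0 \<and> dx1 has degree 2, so coefficients have degree i - 2, and the cofactors of the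
  partial derivatives have degree (i - 2) - (\<mu> - 1).\<close>

lemma HF_Omega2_dim: "HF_Omega I 2 i + vectorspace.dim base_field (vsp sc (J (i - 1 - \<mu>))) = nat (i - 1)"
proof -
  let ?S = "{f \<odot>\<^bsub>\<Lambda>\<^esub> wedge R \<Omega> xs | f a xs ds. f \<in> coord_part I a \<and> length xs = 2 \<and> length ds = 2 \<and>
    (\<forall>j<2. xs ! j \<in> Omega1_part I (ds ! j)) \<and> a + sum_list ds = i}"
  have part: "Omega2_part i = LinearCombinations.module.span base_field (restrict_scalars (coord_const I) \<Lambda>) ?S"
    by (simp add: Omega2_part_def exterior_part_def)
  have gen: "?S \<subseteq> \<Psi> ` forms (i - 2)"
  proof
    fix x assume "x \<in> ?S"
    then obtain f a xs ds where f: "f \<in> coord_part I a" and len: "length xs = 2" "length ds = 2"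
      and part: "\<forall>j<2. xs ! j \<in> Omega1_part I (ds ! j)" and i: "a + sum_list ds = i"
      and x: "x = f \<odot>\<^bsub>\<Lambda>\<^esub> wedge R \<Omega> xs" by blast
    obtain v w where xs: "xs = [v, w]" using len(1) by (auto simp: numeral_2_eq_2 length_Suc_conv)
    obtain b c where ds: "ds = [b, c]" using len(2) by (auto simp: numeral_2_eq_2 length_Suc_conv)
    have "v \<in> Omega1_part I b" "w \<in> Omega1_part I c"
      using part[rule_format, of 0] part[rule_format, of 1] by (simp_all add: xs ds)
    then obtain p q p' q' where vw: "v = \<Phi> (p, q)" "w = \<Phi> (p', q')"
      and pq: "p \<in> forms (b - 1)" "q \<in> forms (b - 1)" "p' \<in> forms (c - 1)" "q' \<in> forms (c - 1)"
      unfolding Omega1_part_image by auto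
    obtain r where r: "f = cls r" "r \<in> forms a" using f by (auto simp: coord_part_eq)
    have "x = \<Psi> (r * minor2 (p, q) (p', q'))"
      unfolding x xs r(1) vw X.wedge2_def[symmetric] wedge_\<Phi> \<Psi>_smult ..
    moreover have "minor2 (p, q) (p', q') \<in> forms ((b - 1) + (c - 1))"
      unfolding minor2_def fst_conv snd_conv by (intro forms_diff forms_mult pq)
    from forms_mult[OF r(2) this] have "r * minor2 (p, q) (p', q') \<in> forms (i - 2)"
      using i by (simp add: ds algebra_simps)
    ultimately show "x \<in> \<Psi> ` forms (i - 2)" by blast
  qed
  then have "?S \<subseteq> carrier \<Lambda>" by (rule subset_trans) auto
  then have own: "?S \<subseteq> Omega2_part i"
    unfolding part
    using Module.module.intro module.in_own_span[OF module_restrict_scalars[OF K.is_cring X.\<Lambda>.module_axioms coord_const_hom]]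
    by simp
  have im: "\<Psi> h \<in> Omega2_part i" if h: "h \<in> forms (i - 2)" for h
  proof -
    have "dR (cls X0) = \<Phi> (1, 0)" "dR (cls X1) = \<Phi> (0, 1)" by (simp_all add: d_cls)
    moreover have "1 \<in> forms 0" using const_forms[of 1] by simp
    ultimately have "dR (cls X0) \<in> Omega1_part I 1" "dR (cls X1) \<in> Omega1_part I 1"
      unfolding Omega1_part_image by auto
    \<comment> \<open>A single generator suffices: coefficient of degree i - 2 and two differentials
      of degree 1.\<close>
    then have "\<Psi> h \<in> ?S"
      unfolding \<Psi>_def \<omega>_def using h
      by (intro CollectI exI[of _ "cls h"] exI[of _ "i - 2"] exI[of _ "[dR (cls X0), dR (cls X1)]"]
          exI[of _ "[1, 1]"]) (auto simp: coord_part_eq less_2)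
    then show ?thesis using own by blast
  qed
  have ker: "J (i - 1 - \<mu>) = {h \<in> forms (i - 2). \<Psi> h = \<zero>\<^bsub>\<Lambda>\<^esub>}"
    using J_forms[of "i - 2"] jac_graded[of _ "i - 2"] by (auto simp: \<Psi>_eq_0_iff)
  have smult: "\<Psi> (sc c h) = coord_const I c \<odot>\<^bsub>\<Lambda>\<^esub> \<Psi> h" for c h
    by (simp add: coord_const_eq \<Psi>_smult)
  note hf = hilbert_fun_quotient(2)[where \<Phi> = \<Psi> and gr = Omega2_part and i = i and S = ?S,
    OF X.\<Lambda>.module_axioms coord_const_hom vectorspace_forms
    coord_space_dim(1)[OF coord_space_forms] vectorspace_J dim_J(1)
    \<Psi>_closed \<Psi>_add smult ker part gen im]
  then show ?thesis
    unfolding coord_space_dim(2)[OF coord_space_forms] by (simp add: HF_Omega_def Omega2_part_def)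
qed

text \<open>The alternating sum of a graded free resolution. With S_d for the forms of degree d, the
  four terms are twice dim S_(i-1), twice dim S_(i-1-\<mu>) for \<open>F dx0\<close> and
  \<open>F dx1\<close>, dim S_(i-\<mu>) for dF, and dim S_(i-\<mu>-s) for the syzygies.\<close>

lemma HF_Omega1_eq:
  "int (HF_Omega1 I i) = 2 * max 0 i - 2 * max 0 (i - \<mu>) - max 0 (i - \<mu> + 1) + max 0 (i - \<mu> + 1 - int s)"
proof -
  obtain n where n: "vectorspace.dim base_field (vsp sc2 (N (i - 1 - \<mu>))) = n" by blast
  have e: "i - 1 - \<mu> + 2 = i - \<mu> + 1" "i - 1 - \<mu> + 1 = i - \<mu>" by simp_all
  have "int (HF_Omega1 I i + n) = int (2 * nat i)"
    "int (n + nat (i - \<mu> + 1 - int s)) = int (nat (i - \<mu> + 1) + 2 * nat (i - \<mu>))"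
    using HF_Omega1_dim[of i] dim_N(2)[of "i - 1 - \<mu>"] unfolding n e by simp_all
  then show ?thesis unfolding of_nat_add of_nat_mult int_nat_eq max_def by simp
qed

text \<open>Here the terms are dim S_(i-2), twice dim S_(i-1-\<mu>) for the two partial derivatives,
  and dim S_(i-\<mu>-s) for their syzygies.\<close>

lemma HF_Omega2_eq:
  "int (HF_Omega I 2 i) = max 0 (i - 1) - 2 * max 0 (i - \<mu>) + max 0 (i - \<mu> + 1 - int s)"
proof -
  obtain n where n: "vectorspace.dim base_field (vsp sc (J (i - 1 - \<mu>))) = n" by blast
  have e: "i - 1 - \<mu> + 2 = i - \<mu> + 1" "i - 1 - \<mu> + 1 = i - \<mu>" by simp_all
  have "int (HF_Omega I 2 i + n) = int (nat (i - 1))"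
    "int (n + nat (i - \<mu> + 1 - int s)) = int (2 * nat (i - \<mu>))"
    using HF_Omega2_dim[of i] dim_J(2)[of "i - 1 - \<mu>"] unfolding n e by simp_all
  then show ?thesis unfolding of_nat_add of_nat_mult int_nat_eq max_def by simp
qed

end

section \<open>The main result\<close>

text \<open>Uniqueness, needed for the definite description: two polynomials that agree at all large
  integers differ by a polynomial with infinitely many roots.\<close>

lemma hilbert_poly_const:
  assumes "\<And>j. j \<ge> r \<Longrightarrow> H j = c"
  shows "hilbert_poly H = [:of_nat c:]"
  unfolding hilbert_poly_def
proof (rule the_equality)
  show "is_hilbert_poly H [:of_nat c:]"
    unfolding is_hilbert_poly_def using assms by (intro exI[of _ r]) auto
  fix p assume "is_hilbert_poly H p"
  then obtain k where k: "\<And>i. i \<ge> k \<Longrightarrow> of_nat (H i) = poly p (of_int i)"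
    by (auto simp: is_hilbert_poly_def)
  have "(of_int :: int \<Rightarrow> rat) ` {max k r..} \<subseteq> {x. poly (p - [:of_nat c:]) x = 0}"
    using k assms by (auto simp flip: k)
  moreover have "infinite ((of_int :: int \<Rightarrow> rat) ` {max k r..})"
    by (simp add: finite_image_iff inj_on_def infinite_Ici)
  ultimately have "p - [:of_nat c:] = 0"
    using poly_roots_finite finite_subset by blast
  then show "p = [:of_nat c:]" by simp
qed

text \<open>An admissible bound below \<open>r\<close> would force the limit value already in degree
  r - 1.\<close>

lemma is_regularity_indexI:
  assumes "\<And>j. j \<ge> r \<Longrightarrow> H j = c" and "H (r - 1) \<noteq> c"
  shows "is_regularity_index H r"
proof -
  have hp: "hilbert_poly H = [:of_nat c:]" using assms(1) by (rule hilbert_poly_const)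
  show ?thesis
    unfolding is_regularity_index_def Let_def hp
  proof (intro conjI ballI)
    show "r \<in> {i. \<forall>j\<ge>i. (of_nat (H j) :: rat) = poly [:of_nat c:] (of_int j)}" using assms(1) by simp
    fix i assume "i \<in> {i. \<forall>j\<ge>i. (of_nat (H j) :: rat) = poly [:of_nat c:] (of_int j)}"
    then have "\<forall>j\<ge>i. H j = c" by simp
    then show "r \<le> i" using assms(2) by (rule_tac ccontr) (auto dest: spec[of _ "r - 1"])
  qed
qed

theorem proposition3p1:
  fixes I :: "'k::field_char_0 poly poly set"
    and s :: nat and m :: "nat \<Rightarrow> nat" and a :: "nat \<Rightarrow> 'k"
    and F :: "'k poly poly" and \<mu> :: int
  assumes "s \<ge> 1"
    and "\<forall>i\<in>{1..s}. m i \<ge> 1"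
    and "\<forall>i\<in>{1..s}. \<forall>j\<in>{1..s}. i \<noteq> j \<longrightarrow> a i \<noteq> a j"
    and "F = (\<Prod>i=1..s. (X1 - const (a i) * X0) ^ m i)"
    and "\<mu> = int (\<Sum>i=1..s. m i)"
    and "zero_dim_scheme I"
    and "I = Idl\<^bsub>P1_ring\<^esub> {F}"
  shows "(\<forall>i. 0 \<le> i \<and> i \<le> \<mu> - 1 \<longrightarrow> int (HF_Omega1 I i) = 2 * i) \<and>
    (\<forall>i. \<mu> \<le> i \<and> i \<le> \<mu> + int s - 1 \<longrightarrow> int (HF_Omega1 I i) = 3 * \<mu> - 1 - i) \<and>
    (\<forall>i. i \<ge> \<mu> + int s - 1 \<longrightarrow> int (HF_Omega1 I i) = 2 * \<mu> - int s) \<and>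
    int (HF_Omega I 2 0) = 0 \<and>
    (\<forall>i. 1 \<le> i \<and> i \<le> \<mu> \<longrightarrow> int (HF_Omega I 2 i) = i - 1) \<and>
    (\<forall>i. \<mu> \<le> i \<and> i \<le> \<mu> + int s - 1 \<longrightarrow> int (HF_Omega I 2 i) = 2 * \<mu> - 1 - i) \<and>
    (\<forall>i. i \<ge> \<mu> + int s - 1 \<longrightarrow> int (HF_Omega I 2 i) = \<mu> - int s) \<and>
    is_regularity_index (HF_Omega1 I) (\<mu> + int s - 1) \<and>
    (\<mu> \<ge> 2 \<longrightarrow> is_regularity_index (HF_Omega I 2) (\<mu> + int s - 1))"
proof -
  interpret sf: split_form s m a
  proof
    show "s \<ge> 1" by (rule assms(1))
    show "m i \<ge> 1" if "i \<in> {1..s}" for i using assms(2) that by blast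
    show "inj_on a {1..s}" by (rule inj_onI) (use assms(3) in blast)
  qed
  have F: "F = sf.F" unfolding assms(4) sf.F_def sf.l_def ..
  have I: "I = sf.I" unfolding assms(7) F sf.I_def ..
  have \<mu>: "\<mu> = sf.\<mu>" unfolding assms(5) sf.\<mu>_def ..
  have \<mu>_ge: "\<mu> \<ge> int s" and s: "int s \<ge> 1" using sf.\<mu>_ge assms(1) by (simp_all add: \<mu>)
  \<comment> \<open>The range of i decides which maxima vanish, so each value of the Hilbert
    functions becomes linear arithmetic.\<close>
  note H1 = sf.HF_Omega1_eq[folded I \<mu>] and H2 = sf.HF_Omega2_eq[folded I \<mu>]
  have "int (HF_Omega1 I i) = 2 * i" if "0 \<le> i" "i \<le> \<mu> - 1" for i
    using that s unfolding H1 max_def by simp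
  moreover have "int (HF_Omega1 I i) = 3 * \<mu> - 1 - i" if "\<mu> \<le> i" "i \<le> \<mu> + int s - 1" for i
    using that s \<mu>_ge unfolding H1 max_def by simp
  moreover have "int (HF_Omega I 2 0) = 0"
    using s \<mu>_ge unfolding H2 max_def by simp
  moreover have "int (HF_Omega I 2 i) = i - 1" if "1 \<le> i" "i \<le> \<mu>" for i
    using that s unfolding H2 max_def by simp
  moreover have "int (HF_Omega I 2 i) = 2 * \<mu> - 1 - i" if "\<mu> \<le> i" "i \<le> \<mu> + int s - 1" for i
    using that s \<mu>_ge unfolding H2 max_def by simp
  moreover have lim1: "int (HF_Omega1 I i) = 2 * \<mu> - int s" if "i \<ge> \<mu> + int s - 1" for i
    using that s \<mu>_ge unfolding H1 max_def by simp
  moreover have lim2: "int (HF_Omega I 2 i) = \<mu> - int s" if "i \<ge> \<mu> + int s - 1" for i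
    using that s \<mu>_ge unfolding H2 max_def by simp
  moreover have "is_regularity_index (HF_Omega1 I) (\<mu> + int s - 1)"
  proof (rule is_regularity_indexI)
    show "HF_Omega1 I j = nat (2 * \<mu> - int s)" if "j \<ge> \<mu> + int s - 1" for j
      using lim1[OF that] by linarith
    \<comment> \<open>For s \<ge> 2 the value here is 2 \<mu> - s + 1, one step before the end of
      the descent. For s = 1 there is no descent: the degree is \<mu> - 1, on the increasing
      stretch, and the value 2 \<mu> - 2 is one below the limit.\<close>
    have "int (HF_Omega1 I (\<mu> + int s - 1 - 1)) \<noteq> 2 * \<mu> - int s"
      using s \<mu>_ge unfolding H1 max_def by (cases "s = 1") simp_all
    then show "HF_Omega1 I (\<mu> + int s - 1 - 1) \<noteq> nat (2 * \<mu> - int s)"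
      using \<mu>_ge s by linarith
  qed
  \<comment> \<open>For \<mu> = 1, hence s = 1, the Hilbert function of \<Omega>^2 is zero in every
    degree, and then no least bound exists. For \<mu> \<ge> 2 and s = 1 the value in degree \<mu> -
    1 is \<mu> - 2, one below the limit.\<close>
  moreover have "is_regularity_index (HF_Omega I 2) (\<mu> + int s - 1)" if "\<mu> \<ge> 2"
  proof (rule is_regularity_indexI)
    show "HF_Omega I 2 j = nat (\<mu> - int s)" if "j \<ge> \<mu> + int s - 1" for j
      using lim2[OF that] by linarith
    have "int (HF_Omega I 2 (\<mu> + int s - 1 - 1)) \<noteq> \<mu> - int s"
      using s \<mu>_ge that unfolding H2 max_def by (cases "s = 1") simp_all
    then show "HF_Omega I 2 (\<mu> + int s - 1 - 1) \<noteq> nat (\<mu> - int s)"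
      using \<mu>_ge by linarith
  qed
  ultimately show ?thesis by blast
qed

end
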